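(* There exist a path-connected Polish space $(X,d)$ and a jointly continuous (continuous-time) random dynamical system $(\Omega,\mathcal{F},\mathbb{P},\theta,\varphi)$ on $X$ which has a weak attractor $A$ such that $A$ attracts every bounded set in probability, i.e. for every bounded set $B\subset X$, $$\sup_{x\in B}d(\varphi_t(\theta_{-t}\omega,x),A(\omega))\to 0\quad\text{in probability as }t\to\infty,$$ and such that $A(\omega)$ is not connected for $\mathbb{P}$-almost every $\omega\in\Omega$.
   Context: Polish space means separable complete metric space $(X,d)$, with Borel $\sigma$-algebra $\mathcal{B}(X)$; "bounded" refers to the metric $d$. A metric dynamical system $(\Omega,\mathcal{F},\mathbb{P},\theta)$ is a probability space $(\Omega,\mathcal{F},\mathbb{P})$ with a group $(\theta_t)_{t\in\mathbb{R}}$ of maps $\Omega\to\Omega$ such that $(t,\omega)\mapsto\theta_t\omega$ is jointly measurable, $\theta_0=\mathrm{id}$, $\theta_{s+t}=\theta_s\circ\theta_t$, and $\mathbb{P}$ is invariant under every $\theta_t$. A random dynamical system (RDS) $(\Omega,\mathcal{F},\mathbb{P},\theta,\varphi)$ on $X$ is a metric dynamical system together with a jointly measurable map $\varphi:\mathbb{R}_+\times\Omega\times X\to X$, $(t,\omega,x)\mapsto\varphi_t(\omega,x)$, such that for all $s,t\in\mathbb{R}_+$, $\omega\in\Omega$, $x\in X$: $\varphi_0(\omega,x)=x$; $\varphi_{s+t}(\omega,x)=\varphi_t(\theta_s\omega,\varphi_s(\omega,x))$; and $x\mapsto\varphi_t(\omega,x)$ is continuous. The RDS is jointly continuous if for each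 $\omega\in\Omega$ the map $(s,t,x)\mapsto\varphi_{t-s}(\theta_s\omega,x)$ is continuous on $\{(s,t)\in\mathbb{R}^2:s\le t\}\times X$. For nonempty $A\subset X$, $d(x,A):=\inf_{a\in A}d(x,a)$. A random compact set is a family $\{A(\omega)\}_{\omega\in\Omega}$ of nonempty subsets of $X$ such that $A(\omega)$ is compact for $\mathbb{P}$-almost every $\omega$ and $\omega\mapsto d(x,A(\omega))$ is $\mathcal{F}$-measurable for each $x\in X$. It is $\varphi$-invariant if for every $t\in\mathbb{R}_+$, $\varphi_t(\omega,A(\omega))=A(\theta_t\omega)$ for $\mathbb{P}$-almost every $\omega$. A weak attractor of the RDS is a random compact set $A$ that is $\varphi$-invariant and such that for every (deterministic) compact set $B\subset X$, $\sup_{x\in B}d(\varphi_t(\theta_{-t}\omega,x),A(\omega))\to0$ in probability as $t\to\infty$. *)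

theory Defs
  imports "HOL-Probability.Probability"
begin

text \<open>
  State spaces are values of the library type \<^typ>\<open>'x metric\<close>: a carrier set with a metric on it.
  As HOL has no quantification over types, an existence claim about spaces has to fix the types of
  their points.  For the state space, \<^typ>\<open>nat \<Rightarrow> real\<close> loses nothing: a separable metric
  space has at most continuum many points, so it is isometric to one whose carrier is a set of real
  sequences (the metric on the carrier is arbitrary).  For the sample space, \<^typ>\<open>real \<Rightarrow> real\<close>
  plays the role of a path space; carrier and sigma-algebra are arbitrary, so every probability
  space with at most as many points as there are functions from the reals to the reals has a copy
  there.
\<close>

definition polish_metric :: "'x metric \<Rightarrow> bool" where
  "polish_metric X \<longleftrightarrow> mcomplete_of X \<and> separable_space (mtopology_of X)"

definition borel_of_metric :: "'x metric \<Rightarrow> 'x measure" where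
  "borel_of_metric X = sigma (mspace X) {U. openin (mtopology_of X) U}"

abbreviation bounded_in_metric :: "'x metric \<Rightarrow> 'x set \<Rightarrow> bool" where
  "bounded_in_metric X \<equiv> Metric_space.mbounded (mspace X) (mdist X)"

text \<open>Only meaningful for nonempty \<open>A \<subseteq> mspace X\<close>.\<close>

definition dist_to_set :: "'x metric \<Rightarrow> 'x \<Rightarrow> 'x set \<Rightarrow> real" where
  "dist_to_set X x A = (INF a\<in>A. mdist X x a)"

locale metric_dynamical_system = prob_space P
  for P :: "'w measure" +
  fixes \<theta> :: "real \<Rightarrow> 'w \<Rightarrow> 'w"
  assumes measurable_shift:
      "(\<lambda>(t, \<omega>). \<theta> t \<omega>) \<in> borel \<Otimes>\<^sub>M P \<rightarrow>\<^sub>M P"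
    and shift_zero: "\<And>\<omega>. \<omega> \<in> space P \<Longrightarrow> \<theta> 0 \<omega> = \<omega>"
    and shift_add: "\<And>s t \<omega>. \<omega> \<in> space P \<Longrightarrow> \<theta> (s + t) \<omega> = \<theta> s (\<theta> t \<omega>)"
    and shift_invariant: "\<And>t. distr P P (\<theta> t) = P"

locale random_dynamical_system = metric_dynamical_system P \<theta>
  for P :: "'w measure" and \<theta> :: "real \<Rightarrow> 'w \<Rightarrow> 'w" +
  fixes X :: "'x metric"
    and \<phi> :: "real \<Rightarrow> 'w \<Rightarrow> 'x \<Rightarrow> 'x"
  assumes measurable_cocycle:
      "(\<lambda>(t, \<omega>, x). \<phi> t \<omega> x)
         \<in> restrict_space borel {0..} \<Otimes>\<^sub>M P \<Otimes>\<^sub>M borel_of_metric X \<rightarrow>\<^sub>M borel_of_metric X"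
    and cocycle_zero:
      "\<And>\<omega> x. \<lbrakk>\<omega> \<in> space P; x \<in> mspace X\<rbrakk> \<Longrightarrow> \<phi> 0 \<omega> x = x"
    and cocycle_add:
      "\<And>s t \<omega> x. \<lbrakk>0 \<le> s; 0 \<le> t; \<omega> \<in> space P; x \<in> mspace X\<rbrakk>
         \<Longrightarrow> \<phi> (s + t) \<omega> x = \<phi> t (\<theta> s \<omega>) (\<phi> s \<omega> x)"
    and cocycle_continuous:
      "\<And>t \<omega>. \<lbrakk>0 \<le> t; \<omega> \<in> space P\<rbrakk>
         \<Longrightarrow> continuous_map (mtopology_of X) (mtopology_of X) (\<phi> t \<omega>)"

definition jointly_continuous_rds ::
  "'w measure \<Rightarrow> (real \<Rightarrow> 'w \<Rightarrow> 'w) \<Rightarrow> 'x metric \<Rightarrow> (real \<Rightarrow> 'w \<Rightarrow> 'x \<Rightarrow> 'x) \<Rightarrow> bool" where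
  "jointly_continuous_rds P \<theta> X \<phi> \<longleftrightarrow>
     random_dynamical_system P \<theta> X \<phi> \<and>
     (\<forall>\<omega>\<in>space P.
        continuous_map
          (prod_topology (top_of_set {(s, t). s \<le> t}) (mtopology_of X)) (mtopology_of X)
          (\<lambda>((s, t), x). \<phi> (t - s) (\<theta> s \<omega>) x))"

definition random_compact_set :: "'w measure \<Rightarrow> 'x metric \<Rightarrow> ('w \<Rightarrow> 'x set) \<Rightarrow> bool" where
  "random_compact_set P X A \<longleftrightarrow>
     (\<forall>\<omega>\<in>space P. A \<omega> \<noteq> {} \<and> A \<omega> \<subseteq> mspace X) \<and>
     (AE \<omega> in P. compactin (mtopology_of X) (A \<omega>)) \<and>
     (\<forall>x\<in>mspace X. (\<lambda>\<omega>. dist_to_set X x (A \<omega>)) \<in> borel_measurable P)"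

definition cocycle_invariant ::
  "'w measure \<Rightarrow> (real \<Rightarrow> 'w \<Rightarrow> 'w) \<Rightarrow> (real \<Rightarrow> 'w \<Rightarrow> 'x \<Rightarrow> 'x) \<Rightarrow> ('w \<Rightarrow> 'x set) \<Rightarrow> bool" where
  "cocycle_invariant P \<theta> \<phi> A \<longleftrightarrow> (\<forall>t\<ge>0. AE \<omega> in P. \<phi> t \<omega> ` A \<omega> = A (\<theta> t \<omega>))"

definition tendsto_zero_in_probability :: "'w measure \<Rightarrow> (real \<Rightarrow> 'w \<Rightarrow> ennreal) \<Rightarrow> bool" where
  "tendsto_zero_in_probability P Y \<longleftrightarrow>
     (\<forall>t\<ge>0. Y t \<in> borel_measurable P) \<and>
     (\<forall>\<epsilon>>0. ((\<lambda>t. measure P {\<omega> \<in> space P. Y t \<omega> > ennreal \<epsilon>}) \<longlongrightarrow> 0) at_top)"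

text \<open>
  The supremum is taken in \<^typ>\<open>ennreal\<close>, since it may be infinite when \<open>B\<close> is bounded but
  not compact; the supremum over the empty set is 0.  For an RDS on a separable space and a random
  compact set \<open>A\<close>, it is automatically measurable in \<open>\<omega>\<close>, being equal to a supremum over a countable
  dense subset of \<open>B\<close>.
\<close>

definition attracts_in_probability ::
  "'w measure \<Rightarrow> (real \<Rightarrow> 'w \<Rightarrow> 'w) \<Rightarrow> 'x metric \<Rightarrow> (real \<Rightarrow> 'w \<Rightarrow> 'x \<Rightarrow> 'x) \<Rightarrow>
   ('w \<Rightarrow> 'x set) \<Rightarrow> 'x set \<Rightarrow> bool" where
  "attracts_in_probability P \<theta> X \<phi> A B \<longleftrightarrow>
     tendsto_zero_in_probability P
       (\<lambda>t \<omega>. SUP x\<in>B. ennreal (dist_to_set X (\<phi> t (\<theta> (- t) \<omega>) x) (A \<omega>)))"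

definition weak_attractor ::
  "'w measure \<Rightarrow> (real \<Rightarrow> 'w \<Rightarrow> 'w) \<Rightarrow> 'x metric \<Rightarrow> (real \<Rightarrow> 'w \<Rightarrow> 'x \<Rightarrow> 'x) \<Rightarrow>
   ('w \<Rightarrow> 'x set) \<Rightarrow> bool" where
  "weak_attractor P \<theta> X \<phi> A \<longleftrightarrow>
     random_compact_set P X A \<and>
     cocycle_invariant P \<theta> \<phi> A \<and>
     (\<forall>B. compactin (mtopology_of X) B \<longrightarrow> attracts_in_probability P \<theta> X \<phi> A B)"

end

theory Submission
  imports Defs
begin

text \<open>
  The state space is the half-line, metrised so that the integers converge to \<open>0\<close> while a path
  from \<open>n\<close> to \<open>n + 1\<close> climbs to a height of order \<open>n\<close>.  A bounded set then stays close to the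
  integers, and any set of integers containing \<open>0\<close> is compact.  During a unit of time at level
  \<open>k\<close>, integers below \<open>blk (k + 1)\<close> are moved down by \<open>blk k\<close>, and everything above is pushed
  towards the integers.  The levels come from independent clocks of periods \<open>2 ^ k\<close>: a level
  above \<open>k\<close> recurs within time \<open>2 ^ (k + 1)\<close>, but every single level is finite.

  The attractor is the set of integers with backward orbits of every length.  It is countable and
  contains \<open>0\<close> and \<open>blk k\<close> for all large \<open>k\<close>, so it is disconnected.  In a window of length \<open>t\<close>
  whose largest level is \<open>K\<close>, starting points below \<open>blk K\<close> end in \<open>0\<close>, and those far above end
  at large integers, which are close to \<open>0\<close>.  An integer in between has an infinite past, because
  \<open>blk (K + 1) / blk K\<close> exceeds the time since the last level above \<open>K\<close>; so it ends in the
  attractor.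
\<close>

subsection \<open>The motion of the integers\<close>

text \<open>Two constraints shape the construction. If some compact connected set contained
  \<open>A \<omega>\<close> with positive probability, then its image after a long time would be
  connected, would contain the attractor of that time and be close to it, again with positive
  probability; in the limit the attractor would be connected with positive probability. So the
  attractor must be compact, yet almost surely leave every fixed compact connected set. The spikes
  allow this: a bounded connected set containing \<open>0\<close> omits all large integers.
  Conversely, a flow that moves infinitely many integers at once carries them over arbitrarily high
  spikes in one unit of time, against continuity at \<open>0\<close>, their limit. So each level
  moves only finitely many integers, although arbitrarily large ones must be dealt with. Randomness
  resolves the conflict: the range that is moved is finite at each time and unbounded over
  time.\<close>

fun blk :: "nat \<Rightarrow> nat" where
  "blk 0 = 0"
| "blk (Suc 0) = 5"
| "blk (Suc (Suc k)) = (2 ^ (k + 3) + 5) * blk (Suc k)"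

text \<open>The term \<open>2 ^ (k + 2)\<close> pays for two spans of \<open>2 ^ (k + 1)\<close>
  steps of size \<open>blk k\<close>: the wait for a level above \<open>k\<close>, and the length of
  a time window whose largest level is \<open>k\<close>. Level \<open>0\<close> moves no integer
  since \<open>blk 0 = 0\<close>, so the bound starts at \<open>1\<close>.\<close>

lemma blk_Suc_ge:
  assumes "1 \<le> k"
  shows "(2 ^ (k + 2) + 5) * blk k \<le> blk (Suc k)"
  using assms by (cases k) (auto simp: power_add)

lemma blk_pos: "1 \<le> k \<Longrightarrow> 0 < blk k"
  by (induction k rule: blk.induct) auto

lemma blk_double_less: "2 * blk k < blk (Suc k)"
proof (cases k)
  case (Suc m)
  have "0 < blk k" using blk_pos Suc by simp
  have "2 * blk k < (2 ^ (k + 2) + 5) * blk k"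
    using \<open>0 < blk k\<close> by (intro mult_strict_right_mono) auto
  also have "\<dots> \<le> blk (Suc k)" using Suc by (intro blk_Suc_ge) simp
  finally show ?thesis .
qed simp

lemma strict_mono_blk: "strict_mono blk"
  unfolding strict_mono_Suc_iff using blk_double_less
  by (metis add_lessD1 mult_2)

lemma blk_mono: "j \<le> k \<Longrightarrow> blk j \<le> blk k"
  using strict_mono_blk by (simp add: strict_mono_less_eq)

lemma le_blk: "k \<le> blk k"
  using strict_mono_blk by (rule strict_mono_imp_increasing)

text \<open>Natural subtraction truncates, so integers up to \<open>blk k\<close> land on
  \<open>0\<close>; this matches the \<open>max 0\<close> in the flow below.\<close>

definition jump :: "nat \<Rightarrow> nat \<Rightarrow> nat" where
  "jump k n = (if blk (Suc k) \<le> n then n else n - blk k)"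

primrec jumps :: "(int \<Rightarrow> nat) \<Rightarrow> int \<Rightarrow> nat \<Rightarrow> nat \<Rightarrow> nat" where
  "jumps l i 0 n = n"
| "jumps l i (Suc m) n = jump (l (i + int m)) (jumps l i m n)"

lemma jump_zero [simp]: "jump k 0 = 0"
  by (simp add: jump_def)

lemma jumps_zero [simp]: "jumps l i m 0 = 0"
  by (induction m) auto

lemma jumps_add: "jumps l i (m + m') n = jumps l (i + int m) m' (jumps l i m n)"
  by (induction m') (auto simp: algebra_simps)

lemma jumps_shift: "jumps (\<lambda>j. l (j + c)) i m n = jumps l (i + c) m n"
  by (induction m) (auto simp: algebra_simps)

lemma jump_ge: "k \<le> K \<Longrightarrow> n \<le> jump k n + blk K"
  using blk_mono[of k K] by (auto simp: jump_def)

lemma jumps_ge: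
  assumes "\<And>j. i \<le> j \<Longrightarrow> j < i + int m \<Longrightarrow> l j \<le> K"
  shows "n \<le> jumps l i m n + m * blk K"
  using assms
proof (induction m)
  case (Suc m)
  have "n \<le> jumps l i m n + m * blk K"
    by (rule Suc.IH) (use Suc.prems in auto)
  moreover have "jumps l i m n \<le> jumps l i (Suc m) n + blk K"
    using jump_ge[of "l (i + int m)" K] Suc.prems by simp
  ultimately show ?case by (simp only: mult_Suc)
qed simp

text \<open>Pasts of every finite length instead of one infinite past: this is a countable condition
  on the levels, hence measurable, and it amounts to the same because preimages under
  \<open>jump\<close> are finite.\<close>

definition ancient :: "(int \<Rightarrow> nat) \<Rightarrow> int \<Rightarrow> nat set" where
  "ancient l i = {n. \<forall>m. \<exists>y. jumps l (i - int m) m y = n}"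

lemma zero_in_ancient: "0 \<in> ancient l i"
  unfolding ancient_def by (auto intro: exI[of _ 0])

lemma ancient_shift: "ancient (\<lambda>j. l (j + c)) i = ancient l (i + c)"
  by (simp add: ancient_def jumps_shift algebra_simps)

lemma finite_jump_preimage: "finite {y. jump k y = n}"
  by (rule finite_subset[of _ "{..n + blk k}"]) (auto simp: jump_def split: if_splits)

text \<open>The inclusion from right to left is a Koenig argument: finitely many preimages share
  pasts of all lengths, and a long past contains the shorter ones, so one preimage has them
  all.\<close>

lemma jump_image_ancient: "jump (l i) ` ancient l i = ancient l (i + 1)"
proof (intro subset_antisym subsetI)
  fix n assume "n \<in> jump (l i) ` ancient l i"
  then obtain z where z: "z \<in> ancient l i" "n = jump (l i) z" by auto
  have "\<exists>y. jumps l (i + 1 - int m) m y = n" for m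
  proof (cases m)
    case (Suc m')
    have "\<exists>y. jumps l (i - int m') m' y = z" using z(1) by (simp add: ancient_def)
    then obtain y where "jumps l (i - int m') m' y = z" ..
    then have "jumps l (i + 1 - int m) m y = n" using Suc z(2) by simp
    then show ?thesis ..
  qed simp
  then show "n \<in> ancient l (i + 1)" by (auto simp: ancient_def)
next
  fix n assume n: "n \<in> ancient l (i + 1)"
  define Z where "Z = {z. jump (l i) z = n}"
  define R where "R m z = (\<exists>y. jumps l (i - int m) m y = z)" for m z
  have "finite Z" unfolding Z_def by (rule finite_jump_preimage)
  have R_ex: "\<exists>z\<in>Z. R m z" for m
  proof -
    obtain y where "jumps l (i + 1 - int (Suc m)) (Suc m) y = n"
      using n unfolding ancient_def by blast
    then have "jump (l i) (jumps l (i - int m) m y) = n" by simp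
    then show ?thesis unfolding Z_def R_def by blast
  qed
  have R_mono: "R m z" if "R m' z" "m \<le> m'" for m m' z
  proof -
    have "\<exists>y. jumps l (i - int m') m' y = z" using that(1) unfolding R_def .
    then obtain y where y: "jumps l (i - int m') m' y = z" ..
    have "jumps l (i - int m) m (jumps l (i - int m') (m' - m) y) = z"
      using jumps_add[of l "i - int m'" "m' - m" m y] y that(2) by (simp add: of_nat_diff)
    then show ?thesis by (auto simp: R_def)
  qed
  have "\<exists>z\<in>Z. \<forall>m. R m z"
  proof (rule ccontr)
    assume "\<not> ?thesis"
    then have "\<forall>z\<in>Z. \<exists>m. \<not> R m z" by blast
    then obtain f where f: "\<And>z. z \<in> Z \<Longrightarrow> \<not> R (f z) z" by metis
    obtain z where z: "z \<in> Z" "R (Max (f ` Z)) z" using R_ex by blast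
    have "f z \<le> Max (f ` Z)" using \<open>finite Z\<close> z(1) by simp
    then show False using R_mono[OF z(2)] f[OF z(1)] by blast
  qed
  then show "n \<in> jump (l i) ` ancient l i"
    unfolding Z_def R_def ancient_def by blast
qed

lemma jumps_image_ancient: "jumps l i m ` ancient l i = ancient l (i + int m)"
proof (induction m)
  case (Suc m)
  have "jumps l i (Suc m) ` ancient l i = jump (l (i + int m)) ` jumps l i m ` ancient l i"
    by (simp add: image_image)
  also have "\<dots> = ancient l (i + int (Suc m))"
    unfolding Suc.IH jump_image_ancient by (simp add: algebra_simps)
  finally show ?case .
qed simp

text \<open>The window \<open>2 ^ (k + 1)\<close> is the period of clock \<open>k + 1\<close>, whose
  ring forces a level of at least \<open>k + 1\<close>.\<close>

definition recurrent_levels :: "(int \<Rightarrow> nat) \<Rightarrow> bool" where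
  "recurrent_levels l \<longleftrightarrow> (\<forall>k i. \<exists>j. i - 2 ^ (k + 1) \<le> j \<and> j < i \<and> k < l j)"

text \<open>
  Follow \<open>n\<close> backwards: below \<open>blk (K + 1)\<close>, each step adds at most \<open>blk K\<close>, until the last time
  at which the level exceeded \<open>K\<close>; there the preimage can be taken beyond \<open>blk (l \<tau>)\<close>, and
  recurrence bounds the waiting time for a still higher level.  The ratio of consecutive values of
  \<open>blk\<close> leaves room for that wait.
\<close>

lemma ancientI:
  assumes l: "recurrent_levels l"
    and K: "1 \<le> K" "blk K \<le> n" and \<tau>: "\<tau> < i" "K < l \<tau>"
    and n: "n + nat (i - \<tau>) * blk K \<le> blk (Suc K)"
  shows "n \<in> ancient l i"
proof -
  \<comment> \<open>With \<open>K\<close> and \<open>\<tau>\<close> quantified, the condition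
    survives a backward step: the left side of the budget inequality does not grow while
    \<open>K\<close> is kept, and meeting a higher level opens a new, larger budget.\<close>
  define S where "S i n \<longleftrightarrow> (\<exists>K \<tau>. 1 \<le> K \<and> blk K \<le> n \<and> \<tau> < i \<and> K < l \<tau> \<and>
    n + nat (i - \<tau>) * blk K \<le> blk (Suc K))" for i n
  have step: "\<exists>y. jump (l (i - 1)) y = n \<and> S (i - 1) y" if "S i n" for i n
  proof -
    from that obtain K \<tau> where K: "1 \<le> K" "blk K \<le> n" and \<tau>: "\<tau> < i" "K < l \<tau>"
      and n: "n + nat (i - \<tau>) * blk K \<le> blk (Suc K)" unfolding S_def by auto
    define k where "k = l (i - 1)"
    have "0 < blk K" using blk_pos K(1) .
    show ?thesis
    proof (cases "K < k")
      case True
      obtain j where j: "i - 1 - 2 ^ (k + 1) \<le> j" "j < i - 1" "k < l j"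
        using l unfolding recurrent_levels_def by blast
      have n_le: "n \<le> blk k" using n blk_mono[of "Suc K" k] True by linarith
      have "nat (i - 1 - j) \<le> 2 ^ (k + 1)"
        using j(1) by (simp add: nat_le_iff)
      then have "n + blk k + nat (i - 1 - j) * blk k \<le> (2 + 2 ^ (k + 1)) * blk k"
        using n_le mult_right_mono[of "nat (i - 1 - j)" "2 ^ (k + 1)" "blk k"]
        unfolding add_mult_distrib mult_2 by linarith
      also have "\<dots> \<le> (2 ^ (k + 2) + 5) * blk k" by (intro mult_right_mono) auto
      also have "\<dots> \<le> blk (Suc k)" using blk_Suc_ge True by simp
      finally have "S (i - 1) (n + blk k)"
        unfolding S_def using j True K by (intro exI[of _ k] exI[of _ j]) auto
      moreover have "jump k (n + blk k) = n"
        using n_le blk_double_less[of k] by (simp add: jump_def)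
      ultimately show ?thesis unfolding k_def by blast
    next
      case False
      then have "\<tau> \<noteq> i - 1" using \<tau>(2) unfolding k_def by auto
      then have \<tau>': "\<tau> < i - 1" using \<tau>(1) by simp
      have eq: "nat (i - \<tau>) * blk K = blk K + nat (i - 1 - \<tau>) * blk K"
      proof -
        have "nat (i - \<tau>) = Suc (nat (i - 1 - \<tau>))" using \<tau>' by linarith
        then show ?thesis by simp
      qed
      show ?thesis
      proof (cases "blk (Suc k) \<le> n")
        case True
        then have "jump k n = n" by (simp add: jump_def)
        moreover have "S (i - 1) n"
          unfolding S_def using K \<tau> \<tau>' n eq by (intro exI[of _ K] exI[of _ \<tau>]) auto
        ultimately show ?thesis unfolding k_def by blast
      next
        case False2: False
        have "k = K"
        proof (rule ccontr)
          assume "k \<noteq> K"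
          then have "blk (Suc k) \<le> blk K" using False by (intro blk_mono) simp
          then show False using False2 K by simp
        qed
        \<comment> \<open>At least one further share of the budget remains after this step, so the
          preimage \<open>n + blk K\<close> is strictly below the barrier \<open>blk (Suc K)\<close>
          and is really moved by level \<open>K\<close>.\<close>
        have "1 * blk K \<le> nat (i - 1 - \<tau>) * blk K" using \<tau>' by (intro mult_right_mono) auto
        then have "n + blk K < blk (Suc K)" using n eq \<open>0 < blk K\<close> by linarith
        then have "jump k (n + blk k) = n" using \<open>k = K\<close> by (simp add: jump_def)
        moreover have "S (i - 1) (n + blk k)"
          unfolding S_def \<open>k = K\<close> using K \<tau> \<tau>' n eq by (intro exI[of _ K] exI[of _ \<tau>]) auto
        ultimately show ?thesis unfolding k_def by blast
      qed
    qed
  qed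
  have "\<exists>y. jumps l (i - int m) m y = n" if "S i n" for i n m
    using that
  proof (induction m arbitrary: i n)
    case (Suc m)
    obtain z where z: "jump (l (i - 1)) z = n" "S (i - 1) z" using step Suc.prems by blast
    obtain y where "jumps l (i - 1 - int m) m y = z" using Suc.IH[OF z(2)] by blast
    then have "jumps l (i - int (Suc m)) (Suc m) y = n"
      using z(1) by (simp add: algebra_simps)
    then show ?case ..
  qed simp
  moreover have "S i n" unfolding S_def using assms by blast
  ultimately show ?thesis by (auto simp: ancient_def)
qed

text \<open>Supplies nonzero points of the attractor. The value \<open>blk K\<close> uses one share
  of the budget in \<open>ancientI\<close>, the wait at most \<open>2 ^ (K + 1)\<close>
  shares.\<close>

lemma blk_in_ancient:
  assumes l: "recurrent_levels l" and K: "1 \<le> K"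
  shows "blk K \<in> ancient l i"
proof -
  obtain j where j: "i - 2 ^ (K + 1) \<le> j" "j < i" "K < l j"
    using l unfolding recurrent_levels_def by blast
  have "nat (i - j) \<le> 2 ^ (K + 1)" using j(1) by (simp add: nat_le_iff)
  then have "blk K + nat (i - j) * blk K \<le> (1 + 2 ^ (K + 1)) * blk K"
    using mult_right_mono[of "nat (i - j)" "2 ^ (K + 1)" "blk K"] by (simp add: add_mult_distrib)
  also have "\<dots> \<le> (2 ^ (K + 2) + 5) * blk K" by (intro mult_right_mono) auto
  also have "\<dots> \<le> blk (Suc K)" using blk_Suc_ge K by simp
  finally show ?thesis by (intro ancientI[OF l K _ j(2,3)]) auto
qed

subsection \<open>The semiflow of one level\<close>

text \<open>Expansion of each unit cell about its midpoint, cut off at the end points; under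
  \<open>spread (exp t)\<close> every point except the midpoints reaches an integer in finite time.
  \<open>max 1 q\<close> keeps the formula continuous for \<open>q < 1\<close>, which occurs when a
  flow is evaluated at \<open>t < s\<close>.\<close>

definition spread :: "real \<Rightarrow> real \<Rightarrow> real" where
  "spread q x = of_int \<lfloor>x\<rfloor> + max 0 (min 1 (max 1 q * (frac x - 1/2) + 1/2))"

lemma spread_floor_le: "of_int \<lfloor>x\<rfloor> \<le> spread q x"
  and spread_le: "spread q x \<le> of_int \<lfloor>x\<rfloor> + 1"
  by (auto simp: spread_def)

lemma spread_ge: "real m \<le> x \<Longrightarrow> real m \<le> spread q x"
proof -
  assume "real m \<le> x"
  then have "int m \<le> \<lfloor>x\<rfloor>" by (simp add: le_floor_iff)
  then have "of_int (int m) \<le> (of_int \<lfloor>x\<rfloor> :: real)" by (simp only: of_int_le_iff)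
  then show ?thesis using spread_floor_le[of x q] by simp
qed

lemma spread_of_int [simp]: "spread q (of_int n) = of_int n"
  by (auto simp: spread_def max_def min_def)

lemma spread_of_nat [simp]: "spread q (real n) = real n"
  using spread_of_int[of q "int n"] by simp

lemma spread_one: "q \<le> 1 \<Longrightarrow> spread q x = x"
  using frac_ge_0[of x] frac_lt_1[of x] by (auto simp: spread_def frac_def max_def min_def)

text \<open>Expansions about the same midpoint multiply, and a point that was cut off is an integer,
  hence fixed. So \<open>spread (exp t)\<close> is a semigroup in \<open>t \<ge> 0\<close>.\<close>

lemma spread_spread:
  assumes "1 \<le> p" "1 \<le> q"
  shows "spread q (spread p x) = spread (q * p) x"
proof -
  define \<delta> where "\<delta> = frac x - 1/2"
  have \<delta>: "- 1/2 \<le> \<delta>" "\<delta> < 1/2"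
    using frac_ge_0[of x] frac_lt_1[of x] by (auto simp: \<delta>_def)
  have qp: "1 \<le> q * p" using assms mult_mono[of 1 q 1 p] by simp
  have x_eq: "spread r x = of_int \<lfloor>x\<rfloor> + max 0 (min 1 (r * \<delta> + 1/2))" if "1 \<le> r" for r
    using that by (simp add: spread_def \<delta>_def max_def)
  consider "p * \<delta> \<ge> 1/2" | "p * \<delta> \<le> - 1/2" | "- 1/2 < p * \<delta>" "p * \<delta> < 1/2" by linarith
  then show ?thesis
  proof cases
    case 1
    have "1/2 \<le> q * (p * \<delta>)" using 1 assms mult_mono[of 1 q "1/2" "p * \<delta>"] by auto
    then have "spread (q * p) x = of_int (\<lfloor>x\<rfloor> + 1)" using x_eq[OF qp] by (simp add: mult.assoc)
    moreover have "spread p x = of_int (\<lfloor>x\<rfloor> + 1)" using x_eq[OF assms(1)] 1 by simp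
    ultimately show ?thesis by (simp only: spread_of_int)
  next
    case 2
    have "q * (p * \<delta>) \<le> - 1/2" using 2 assms mult_mono[of 1 q "1/2" "- p * \<delta>"] by auto
    then have "spread (q * p) x = of_int \<lfloor>x\<rfloor>" using x_eq[OF qp] by (simp add: mult.assoc)
    moreover have "spread p x = of_int \<lfloor>x\<rfloor>" using x_eq[OF assms(1)] 2 by simp
    ultimately show ?thesis by (simp only: spread_of_int)
  next
    case 3
    then have *: "spread p x = of_int \<lfloor>x\<rfloor> + (p * \<delta> + 1/2)" using x_eq[OF assms(1)] by simp
    have "\<lfloor>spread p x\<rfloor> = \<lfloor>x\<rfloor>" unfolding * using 3 by (simp add: floor_eq_iff)
    then have "frac (spread p x) - 1/2 = p * \<delta>" unfolding frac_def * by simp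
    then show ?thesis
      unfolding x_eq[OF qp] using \<open>\<lfloor>spread p x\<rfloor> = \<lfloor>x\<rfloor>\<close> assms
      by (simp add: spread_def[of q] mult.assoc)
  qed
qed

lemma infdist_Ints: "infdist x \<int> = min (frac x) (1 - frac x)"
proof (rule antisym)
  have "infdist x \<int> \<le> dist x (of_int \<lfloor>x\<rfloor>)" "infdist x \<int> \<le> dist x (of_int (\<lfloor>x\<rfloor> + 1))"
    by (rule infdist_le, simp)+
  moreover have "dist x (of_int \<lfloor>x\<rfloor>) = frac x" "dist x (of_int (\<lfloor>x\<rfloor> + 1)) = 1 - frac x"
    by (simp_all add: dist_real_def frac_def)
  ultimately show "infdist x \<int> \<le> min (frac x) (1 - frac x)" by simp
  have "min (frac x) (1 - frac x) \<le> dist x y" if y: "y \<in> \<int>" for y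
  proof -
    obtain i where i: "y = of_int i" using y by (auto elim: Ints_cases)
    consider "i \<le> \<lfloor>x\<rfloor>" | "\<lfloor>x\<rfloor> + 1 \<le> i" by linarith
    then show ?thesis
    proof cases
      case 1
      then have "y \<le> of_int \<lfloor>x\<rfloor>" using i by simp
      then show ?thesis by (simp add: dist_real_def frac_def)
    next
      case 2
      then have "of_int (\<lfloor>x\<rfloor> + 1) \<le> y" using i by (simp only: of_int_le_iff)
      then show ?thesis by (simp add: dist_real_def frac_def)
    qed
  qed
  then show "min (frac x) (1 - frac x) \<le> infdist x \<int>"
    by (subst infdist_def) (auto intro!: cINF_greatest)
qed

text \<open>Serves twice: it bounds the elevation of the image far out, and it keeps a point close
  to the integers during an incomplete first time interval.\<close>

lemma infdist_spread_le: "infdist (spread q x) \<int> \<le> infdist x \<int>"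
proof -
  define \<delta> where "\<delta> = frac x - 1/2"
  have \<delta>: "- 1/2 \<le> \<delta>" "\<delta> < 1/2"
    using frac_ge_0[of x] frac_lt_1[of x] by (auto simp: \<delta>_def)
  define r where "r = max 1 q"
  have "1 \<le> r" by (simp add: r_def)
  have sp: "spread q x = of_int \<lfloor>x\<rfloor> + max 0 (min 1 (r * \<delta> + 1/2))"
    by (simp add: spread_def \<delta>_def r_def)
  have 1: "infdist (spread q x) \<int> \<le> dist (spread q x) (of_int \<lfloor>x\<rfloor>)"
    and 2: "infdist (spread q x) \<int> \<le> dist (spread q x) (of_int (\<lfloor>x\<rfloor> + 1))"
    by (rule infdist_le, simp)+
  have eq: "infdist x \<int> = min (\<delta> + 1/2) (1/2 - \<delta>)" by (simp add: infdist_Ints \<delta>_def)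
  show ?thesis
  proof (cases "\<delta> \<ge> 0")
    case True
    have "1 * \<delta> \<le> r * \<delta>" using True \<open>1 \<le> r\<close> by (intro mult_right_mono)
    then have "dist (spread q x) (of_int (\<lfloor>x\<rfloor> + 1)) \<le> 1/2 - \<delta>"
      unfolding sp dist_real_def using True \<delta> by (auto simp: max_def min_def)
    then show ?thesis using 2 eq True by simp
  next
    case False
    have "1 * - \<delta> \<le> r * - \<delta>" using False \<open>1 \<le> r\<close> by (intro mult_right_mono) auto
    then have "r * \<delta> \<le> \<delta>" by linarith
    then have "dist (spread q x) (of_int \<lfloor>x\<rfloor>) \<le> 1/2 + \<delta>"
      unfolding sp dist_real_def using False \<delta> by linarith
    then show ?thesis using 1 eq False by simp
  qed
qed

text \<open>Distance at most 1/8 from the integers means offset at least 3/8 from the midpoint, and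
  twice that exceeds the half length 1/2 of the cell.\<close>

lemma spread_exp_in_Ints:
  assumes "infdist x \<int> \<le> 1/8" "2 \<le> q"
  shows "\<exists>n. spread q x = of_int n"
proof -
  define \<delta> where "\<delta> = frac x - 1/2"
  have sp: "spread q x = of_int \<lfloor>x\<rfloor> + max 0 (min 1 (q * \<delta> + 1/2))"
    using assms by (simp add: spread_def \<delta>_def max_def)
  have "3/8 \<le> \<delta> \<or> \<delta> \<le> - 3/8" using assms(1) unfolding infdist_Ints \<delta>_def by linarith
  then show ?thesis
  proof
    assume "3/8 \<le> \<delta>"
    then have "2 * (3/8) \<le> q * \<delta>" using assms by (intro mult_mono) auto
    then have "spread q x = of_int (\<lfloor>x\<rfloor> + 1)" unfolding sp by simp
    then show ?thesis by blast
  next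
    assume "\<delta> \<le> - 3/8"
    then have "2 * (3/8) \<le> q * - \<delta>" using assms by (intro mult_mono) auto
    then have "spread q x = of_int \<lfloor>x\<rfloor>" unfolding sp by simp
    then show ?thesis by blast
  qed
qed

lemma tendsto_spread:
  assumes q: "(q \<longlongrightarrow> q0) F" and x: "(x \<longlongrightarrow> x0) F"
  shows "((\<lambda>z. spread (q z) (x z)) \<longlongrightarrow> spread q0 x0) F"
proof (cases "x0 \<in> \<int>")
  case False
  define n where "n = \<lfloor>x0\<rfloor>"
  have "of_int n \<noteq> x0" using False by (metis Ints_of_int)
  then have n: "of_int n < x0" "x0 < of_int n + 1"
    unfolding n_def by linarith+
  have "\<forall>\<^sub>F z in F. of_int n < x z" "\<forall>\<^sub>F z in F. x z < of_int n + 1"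
    using x n order_tendsto_iff by blast+
  then have "\<forall>\<^sub>F z in F. spread (q z) (x z) =
      of_int n + max 0 (min 1 (max 1 (q z) * (x z - of_int n - 1/2) + 1/2))"
  proof eventually_elim
    case (elim z)
    then have "\<lfloor>x z\<rfloor> = n" by (simp add: floor_eq_iff)
    then show ?case by (simp add: spread_def frac_def)
  qed
  moreover have "((\<lambda>z. of_int n + max 0 (min 1 (max 1 (q z) * (x z - of_int n - 1/2) + 1/2)))
      \<longlongrightarrow> of_int n + max 0 (min 1 (max 1 q0 * (x0 - of_int n - 1/2) + 1/2))) F"
    by (intro tendsto_intros q x)
  moreover have "of_int n + max 0 (min 1 (max 1 q0 * (x0 - of_int n - 1/2) + 1/2)) = spread q0 x0"
    by (simp add: spread_def frac_def n_def)
  ultimately show ?thesis by (simp add: tendsto_cong)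
next
  case True
  then obtain n where n: "x0 = of_int n" by (auto elim: Ints_cases)
  \<comment> \<open>The floor jumps at an integer, but \<open>spread\<close> does not increase the
    distance to a nearby integer, whatever the factor \<open>p\<close>; this replaces a computation
    of limits from both sides.\<close>
  have close: "\<bar>spread p y - of_int n\<bar> \<le> \<bar>y - of_int n\<bar>" if y: "\<bar>y - of_int n\<bar> < 1/2" for p y
  proof (cases "of_int n \<le> y")
    case True
    then have fl: "\<lfloor>y\<rfloor> = n" using y by (auto simp: floor_eq_iff)
    have "1 * (1/2 - (y - of_int n)) \<le> max 1 p * (1/2 - (y - of_int n))"
      using y by (intro mult_right_mono) linarith+
    then show ?thesis using True by (auto simp: spread_def frac_def fl max_def min_def algebra_simps)
  next
    case False
    then have fl: "\<lfloor>y\<rfloor> = n - 1" using y by (auto simp: floor_eq_iff)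
    have "1 * (y - of_int n + 1/2) \<le> max 1 p * (y - of_int n + 1/2)"
      using y by (intro mult_right_mono) linarith+
    moreover have "frac y - 1/2 = y - of_int n + 1/2" by (simp add: frac_def fl)
    ultimately have *: "y - of_int n + 1/2 \<le> max 1 p * (frac y - 1/2)"
      by (simp only: mult_1)
    have "spread p y = of_int n - 1 + max 0 (min 1 (max 1 p * (frac y - 1/2) + 1/2))"
      by (simp add: spread_def fl)
    then show ?thesis using False * y by (simp only:) (auto simp: max_def min_def)
  qed
  have "((\<lambda>z. \<bar>x z - of_int n\<bar>) \<longlongrightarrow> 0) F"
    using x unfolding n by (simp add: LIM_zero_iff tendsto_rabs_zero_iff)
  moreover have "\<forall>\<^sub>F z in F. norm (spread (q z) (x z) - of_int n) \<le> \<bar>x z - of_int n\<bar>"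
  proof -
    have "\<forall>\<^sub>F z in F. \<bar>x z - of_int n\<bar> < 1/2"
      using tendstoD[OF x, of "1/2"] by (simp add: n dist_real_def)
    then show ?thesis by eventually_elim (use close in auto)
  qed
  ultimately have "((\<lambda>z. spread (q z) (x z) - of_int n) \<longlongrightarrow> 0) F"
    by (rule Lim_null_comparison[rotated])
  then show ?thesis by (simp add: n LIM_zero_iff)
qed

section \<open>Sliding down below a fixed barrier\<close>

text \<open>
  The map \<open>fwd \<tau>\<close> is the time-\<open>\<tau>\<close> map of an isotopy of \<open>[0, \<infinity>)\<close> that fixes \<open>0\<close> and translates
  \<open>[1, \<infinity>)\<close>; its inverse is \<open>bwd \<tau>\<close>.
\<close>

definition fwd :: "real \<Rightarrow> real \<Rightarrow> real" where
  "fwd \<tau> y = y + \<tau> * min y 1"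

definition bwd :: "real \<Rightarrow> real \<Rightarrow> real" where
  "bwd \<tau> y = max (y - \<tau>) (y / (1 + \<tau>))"

text \<open>The maximum makes continuity evident, the case distinction serves computations. The
  difference of the two terms has the sign of \<open>y - (1 + \<tau>)\<close>.\<close>

lemma bwd_eq:
  assumes "0 \<le> \<tau>"
  shows "bwd \<tau> y = (if 1 + \<tau> \<le> y then y - \<tau> else y / (1 + \<tau>))"
proof -
  have "y - \<tau> - y / (1 + \<tau>) = \<tau> * (y - (1 + \<tau>)) / (1 + \<tau>)"
    using assms by (simp add: field_simps)
  moreover have "0 \<le> \<tau> * (y - (1 + \<tau>)) / (1 + \<tau>)" if "1 + \<tau> \<le> y"
    using assms that by simp
  moreover have "\<tau> * (y - (1 + \<tau>)) / (1 + \<tau>) \<le> 0" if "\<not> 1 + \<tau> \<le> y"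
    using assms that by (intro divide_nonpos_nonneg mult_nonneg_nonpos) auto
  ultimately show ?thesis unfolding bwd_def by (cases "1 + \<tau> \<le> y") (simp_all add: max_def)
qed

lemma bwd_fwd: "0 \<le> \<tau> \<Longrightarrow> bwd \<tau> (fwd \<tau> y) = y"
proof -
  assume \<tau>: "0 \<le> \<tau>"
  show ?thesis
  proof (cases "1 \<le> y")
    case True
    then show ?thesis using \<tau> by (simp add: bwd_eq fwd_def)
  next
    case False
    then have f: "fwd \<tau> y = (1 + \<tau>) * y" by (simp add: fwd_def algebra_simps)
    have "(1 + \<tau>) * y < (1 + \<tau>) * 1" using False \<tau> by (intro mult_strict_left_mono) auto
    then show ?thesis using \<tau> by (simp add: bwd_eq f)
  qed
qed

lemma fwd_bwd: "0 \<le> \<tau> \<Longrightarrow> fwd \<tau> (bwd \<tau> y) = y"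
proof -
  assume \<tau>: "0 \<le> \<tau>"
  show ?thesis
  proof (cases "1 + \<tau> \<le> y")
    case True
    then show ?thesis using \<tau> by (simp add: bwd_eq fwd_def)
  next
    case False
    then have "y / (1 + \<tau>) \<le> 1" using \<tau> by simp
    moreover have "y / (1 + \<tau>) + \<tau> * (y / (1 + \<tau>)) = y"
      using \<tau> by (simp add: field_simps add_nonneg_eq_0_iff)
    ultimately show ?thesis using \<tau> False by (simp add: bwd_eq fwd_def)
  qed
qed

lemma fwd_mono: "0 \<le> \<tau> \<Longrightarrow> \<tau> \<le> \<tau>' \<Longrightarrow> 0 \<le> y \<Longrightarrow> fwd \<tau> y \<le> fwd \<tau>' y"
  by (auto simp: fwd_def intro: mult_right_mono)

lemma bwd_nonneg: "0 \<le> \<tau> \<Longrightarrow> 0 \<le> y \<Longrightarrow> 0 \<le> bwd \<tau> y"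
  by (simp add: bwd_eq)

lemma le_fwd_bwd: "0 \<le> \<tau> \<Longrightarrow> \<tau> \<le> \<tau>' \<Longrightarrow> 0 \<le> y \<Longrightarrow> y \<le> fwd \<tau>' (bwd \<tau> y)"
  using fwd_mono[of \<tau> \<tau>' "bwd \<tau> y"] fwd_bwd[of \<tau> y] bwd_nonneg[of \<tau> y] by simp

text \<open>Below the barrier \<open>b\<close> the distance \<open>b - x\<close> is stretched by
  \<open>fwd\<close>, which fixes \<open>0\<close>, so the two regimes meet continuously at
  \<open>b\<close>. The maps \<open>fwd \<tau>\<close> do not form a one-parameter semigroup; hence
  the motion is undone back to time \<open>0\<close> by \<open>bwd\<close> and depends on
  \<open>s\<close> and \<open>t\<close> separately.\<close>

definition flow :: "nat \<Rightarrow> real \<Rightarrow> real \<Rightarrow> real \<Rightarrow> real" where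
  "flow k s t x = (let b = real (blk (Suc k)); c = real (blk k) in
     if b \<le> x then spread (exp (t - s)) x else max 0 (b - fwd (c * t) (bwd (c * s) (b - x))))"

lemma flow_eq_spread: "real (blk (Suc k)) \<le> x \<Longrightarrow> flow k s t x = spread (exp (t - s)) x"
  by (simp add: flow_def Let_def)

lemma flow_eq_fwd:
  "x < real (blk (Suc k)) \<Longrightarrow>
    flow k s t x = max 0 (real (blk (Suc k)) -
      fwd (real (blk k) * t) (bwd (real (blk k) * s) (real (blk (Suc k)) - x)))"
  by (simp add: flow_def Let_def)

lemma flow_nonneg: "0 \<le> x \<Longrightarrow> 0 \<le> flow k s t x"
  using spread_ge[of 0 x] by (auto simp: flow_def Let_def)

lemma flow_le:
  assumes "0 \<le> s" "s \<le> t" "0 \<le> x" "x < real (blk (Suc k))"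
  shows "flow k s t x \<le> x"
  using le_fwd_bwd[of "real (blk k) * s" "real (blk k) * t" "real (blk (Suc k)) - x"] assms
  by (auto simp: flow_eq_fwd mult_left_mono)

text \<open>Spreading rises at most to the next integer and sliding only descends. So a point that
  starts below \<open>blk K\<close> is still there when level \<open>K\<close> arrives.\<close>

lemma flow_le_of_nat:
  assumes "0 \<le> s" "s \<le> t" "0 \<le> x" "x \<le> real n"
  shows "flow k s t x \<le> real n"
proof (cases "real (blk (Suc k)) \<le> x")
  case True
  show ?thesis
  proof (cases "x = real n")
    case False
    then have "\<lfloor>x\<rfloor> < int n" using assms by (simp add: floor_less_iff)
    then have "\<lfloor>x\<rfloor> + 1 \<le> int n" by simp
    then have "of_int (\<lfloor>x\<rfloor> + 1) \<le> real n" by (metis of_int_le_iff of_int_of_nat_eq)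
    then show ?thesis using spread_le[of "exp (t - s)" x] True by (simp add: flow_eq_spread)
  qed (use True in \<open>simp add: flow_eq_spread\<close>)
next
  case False
  then show ?thesis using flow_le[of s t x k] assms by simp
qed

lemma flow_refl: "0 \<le> s \<Longrightarrow> 0 \<le> x \<Longrightarrow> flow k s s x = x"
  by (simp add: flow_def Let_def spread_one fwd_bwd)

lemma flow_flow:
  assumes "0 \<le> s" "s \<le> t" "t \<le> u" "0 \<le> x"
  shows "flow k t u (flow k s t x) = flow k s u x"
proof (cases "real (blk (Suc k)) \<le> x")
  case True
  then have "flow k s t x = spread (exp (t - s)) x" by (rule flow_eq_spread)
  moreover have "real (blk (Suc k)) \<le> spread (exp (t - s)) x" using True by (rule spread_ge)
  ultimately show ?thesis
    using True assms by (simp add: flow_eq_spread spread_spread flip: exp_add)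
next
  case False
  define b c where "b = real (blk (Suc k))" and "c = real (blk k)"
  have fl: "flow k s t x = max 0 (b - fwd (c * t) (bwd (c * s) (b - x)))"
    if "x < b" for s t x using that unfolding b_def c_def by (rule flow_eq_fwd)
  have "x < b" using False by (simp add: b_def)
  have "0 < b" using \<open>x < b\<close> assms by simp
  have c: "0 \<le> c * s" "c * s \<le> c * t" "c * t \<le> c * u" "0 \<le> c * t"
    using assms by (auto simp: c_def intro: mult_left_mono)
  define w where "w = bwd (c * s) (b - x)"
  have "0 \<le> w" using bwd_nonneg c \<open>x < b\<close> by (simp add: w_def)
  define z where "z = fwd (c * t) w"
  have "b - x \<le> z" using le_fwd_bwd[OF c(1,2)] \<open>x < b\<close> by (simp add: z_def w_def)
  have u: "flow k s u x = max 0 (b - fwd (c * u) w)" using fl[OF \<open>x < b\<close>] by (simp add: w_def)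
  have t: "flow k s t x = max 0 (b - z)" using fl[OF \<open>x < b\<close>] by (simp add: z_def w_def)
  show ?thesis
  proof (cases "z \<le> b")
    case True
    have "b - z < b" using \<open>b - x \<le> z\<close> \<open>x < b\<close> by simp
    then show ?thesis using True u t fl[of "b - z" t u] bwd_fwd[OF c(4)] by (simp add: z_def)
  next
    \<comment> \<open>The trajectory has already been stopped at \<open>0\<close>. The path without
      the stop only descends further, and restarting from \<open>0\<close> cannot rise.\<close>
    case False
    have "z \<le> fwd (c * u) w" unfolding z_def using c \<open>0 \<le> w\<close> by (intro fwd_mono)
    then have "flow k s u x = 0" using False u by simp
    moreover have "b \<le> fwd (c * u) (bwd (c * t) b)" using c \<open>0 < b\<close> by (intro le_fwd_bwd) auto
    then have "flow k t u 0 = 0" using fl[OF \<open>0 < b\<close>] by simp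
    ultimately show ?thesis using t False by simp
  qed
qed

lemma flow_of_nat_fixed: "blk (Suc k) \<le> n \<Longrightarrow> flow k s t (real n) = real n"
  by (simp add: flow_eq_spread)

lemma flow_of_nat: "flow k 0 1 (real n) = real (jump k n)"
proof (cases "blk (Suc k) \<le> n")
  case False
  then have "1 \<le> real (blk (Suc k)) - real n" by linarith
  then show ?thesis
    using False by (auto simp: flow_eq_fwd jump_def bwd_def fwd_def max_def of_nat_diff)
qed (simp add: flow_of_nat_fixed jump_def)

lemma flow_zero [simp]: "0 \<le> s \<Longrightarrow> s \<le> t \<Longrightarrow> flow k s t 0 = 0"
  using flow_le_of_nat[of s t 0 0 k] flow_nonneg[of 0 k s t] by simp

lemma tendsto_flow:
  assumes s: "(s \<longlongrightarrow> s0) F" and t: "(t \<longlongrightarrow> t0) F" and x: "(x \<longlongrightarrow> x0) F"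
    and s0: "0 \<le> s0"
  shows "((\<lambda>z. flow k (s z) (t z) (x z)) \<longlongrightarrow> flow k s0 t0 x0) F"
proof -
  define b c where "b = real (blk (Suc k))" and "c = real (blk k)"
  define f where "f s t x = max 0 (b - fwd (c * t) (bwd (c * s) (b - x)))" for s t x
  have fl: "flow k s t x = (if b \<le> x then spread (exp (t - s)) x else f s t x)" for s t x
    by (simp add: flow_def Let_def f_def b_def c_def)
  have "1 + c * s0 \<noteq> 0" using s0 by (simp add: c_def add_nonneg_eq_0_iff)
  then have f: "((\<lambda>z. f (s z) (t z) (x z)) \<longlongrightarrow> f s0 t0 x0) F"
    unfolding f_def fwd_def bwd_def by (intro tendsto_intros s t x)
  have sp: "((\<lambda>z. spread (exp (t z - s z)) (x z)) \<longlongrightarrow> spread (exp (t0 - s0)) x0) F"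
    by (intro tendsto_spread tendsto_intros s t x)
  show ?thesis
  proof (cases x0 b rule: linorder_cases)
    case less
    then have "\<forall>\<^sub>F z in F. x z < b" using x order_tendstoD by blast
    then have "\<forall>\<^sub>F z in F. flow k (s z) (t z) (x z) = f (s z) (t z) (x z)"
      by eventually_elim (simp add: fl)
    then show ?thesis using f less by (simp add: tendsto_cong fl)
  next
    case greater
    then have "\<forall>\<^sub>F z in F. b < x z" using x order_tendstoD by blast
    then have "\<forall>\<^sub>F z in F. flow k (s z) (t z) (x z) = spread (exp (t z - s z)) (x z)"
      by eventually_elim (simp add: fl)
    then show ?thesis using sp greater by (simp add: tendsto_cong fl)
  next
    \<comment> \<open>Both formulas give \<open>b\<close> at the barrier, because \<open>fwd\<close>
      and \<open>bwd\<close> fix \<open>0\<close> and \<open>spread\<close> fixes integers.\<close>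
    case equal
    have "0 < b" using blk_pos by (simp add: b_def)
    moreover have "0 \<le> c * s0" using s0 by (simp add: c_def)
    ultimately have "f s0 t0 x0 = b" using equal
      by (simp add: f_def fwd_def bwd_def)
    moreover have "spread (exp (t0 - s0)) x0 = b" unfolding equal b_def by simp
    ultimately show ?thesis
      using filterlim_If[of "\<lambda>z. spread (exp (t z - s z)) (x z)" "nhds b" F "\<lambda>z. b \<le> x z"
          "\<lambda>z. f (s z) (t z) (x z)"] f sp equal
      by (simp add: fl tendsto_mono[OF inf_le1])
  qed
qed

subsection \<open>A metric on the half-line with spikes between the integers\<close>

text \<open>Vanishes at \<open>0\<close> and at infinity, which lets the integers converge to
  \<open>0\<close>. It does not distinguish \<open>x\<close> from \<open>1 / x\<close>; the
  elevation has to.\<close>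

definition nearness :: "real \<Rightarrow> real" where
  "nearness x = x / (1 + x\<^sup>2)"

definition elevation :: "real \<Rightarrow> real" where
  "elevation x = \<bar>x\<bar> * infdist x \<int>"

text \<open>A railway metric: heights on one spike are compared directly, whereas a change of cell
  costs the descent to the ground and the ascent again. Positions along the ground are compared by
  \<open>nearness\<close>.\<close>

definition spike_dist :: "real \<Rightarrow> real \<Rightarrow> real" where
  "spike_dist x y = \<bar>nearness x - nearness y\<bar> +
     (if \<lfloor>x\<rfloor> = \<lfloor>y\<rfloor> then \<bar>elevation x - elevation y\<bar> else elevation x + elevation y)"

lemma nearness_nonneg: "0 \<le> x \<Longrightarrow> 0 \<le> nearness x"
  by (simp add: nearness_def)

lemma elevation_nonneg: "0 \<le> elevation x"
  by (simp add: elevation_def infdist_nonneg)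

lemma elevation_of_nat [simp]: "elevation (real n) = 0"
  by (simp add: elevation_def)

lemma nearness_le_inverse: "0 < x \<Longrightarrow> nearness x \<le> 1 / x"
  using sum_power2_gt_zero_iff[of 1 x] by (simp add: nearness_def divide_simps power2_eq_square)

lemma nearness_le: "0 \<le> x \<Longrightarrow> nearness x \<le> x"
  using mult_left_mono[of 1 "1 + x\<^sup>2" x] sum_power2_gt_zero_iff[of 1 x]
  by (simp add: nearness_def pos_divide_le_eq)

lemma nearness_eq_iff: "nearness x = nearness y \<longleftrightarrow> x = y \<or> x * y = 1"
proof -
  have pos: "1 + x\<^sup>2 \<noteq> 0" "1 + y\<^sup>2 \<noteq> 0"
    using sum_power2_gt_zero_iff[of 1 x] sum_power2_gt_zero_iff[of 1 y] by simp_all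
  have "nearness x = nearness y \<longleftrightarrow> x * (1 + y\<^sup>2) = y * (1 + x\<^sup>2)"
    unfolding nearness_def using pos by (rule frac_eq_eq)
  also have "\<dots> \<longleftrightarrow> (x - y) * (1 - x * y) = 0"
    by (simp add: algebra_simps power2_eq_square) 
  finally show ?thesis by auto
qed

lemma continuous_on_nearness: "continuous_on UNIV nearness"
  unfolding nearness_def
  by (intro continuous_intros ballI) (metis add_nonneg_eq_0_iff one_neq_zero zero_le_one zero_le_power2)

lemma continuous_on_elevation: "continuous_on UNIV elevation"
  unfolding elevation_def by (intro continuous_intros)

lemma tendsto_nearness: "(u \<longlongrightarrow> x) F \<Longrightarrow> ((\<lambda>z. nearness (u z)) \<longlongrightarrow> nearness x) F"
  using continuous_on_tendsto_compose[OF continuous_on_nearness] by simp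

lemma tendsto_elevation: "(u \<longlongrightarrow> x) F \<Longrightarrow> ((\<lambda>z. elevation (u z)) \<longlongrightarrow> elevation x) F"
  using continuous_on_tendsto_compose[OF continuous_on_elevation] by simp

lemma spike_dist_commute: "spike_dist x y = spike_dist y x"
  by (auto simp: spike_dist_def)

lemma spike_dist_self [simp]: "spike_dist x x = 0"
  by (simp add: spike_dist_def)

lemma spike_dist_nonneg [simp]: "0 \<le> spike_dist x y"
  using elevation_nonneg[of x] elevation_nonneg[of y] by (simp add: spike_dist_def)

lemma spike_dist_triangle: "spike_dist x z \<le> spike_dist x y + spike_dist y z"
  using elevation_nonneg[of x] elevation_nonneg[of y] elevation_nonneg[of z] unfolding spike_dist_def by (simp split: if_split) (smt (verit))

lemma spike_dist_zero: "0 \<le> x \<Longrightarrow> spike_dist x 0 = nearness x + elevation x"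
  using elevation_nonneg[of x] nearness_nonneg[of x] by (auto simp: spike_dist_def nearness_def elevation_def)

lemma nearness_le_spike_dist: "\<bar>nearness x - nearness y\<bar> \<le> spike_dist x y"
  using elevation_nonneg[of x] elevation_nonneg[of y] by (auto simp: spike_dist_def)

lemma elevation_le_spike_dist: "\<bar>elevation x - elevation y\<bar> \<le> spike_dist x y"
  using elevation_nonneg[of x] elevation_nonneg[of y] by (auto simp: spike_dist_def)

lemma infdist_Ints_eq_zero_iff: "infdist x \<int> = 0 \<longleftrightarrow> x \<in> \<int>" for x :: real
  unfolding infdist_Ints frac_eq_0_iff[symmetric]
  using frac_ge_0[of x] frac_lt_1[of x] by (intro iffI; linarith)

text \<open>Nearness leaves only \<open>x * y = 1\<close> to exclude. In one cell, both points are
  below \<open>1\<close> or both are at least \<open>1\<close>, so only \<open>x = y = 1\<close> is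
  possible; in different cells both elevations vanish, and integers with product \<open>1\<close>
  are equal.\<close>

lemma spike_dist_eq_zero_iff:
  assumes "0 \<le> x" "0 \<le> y"
  shows "spike_dist x y = 0 \<longleftrightarrow> x = y"
proof
  assume 0: "spike_dist x y = 0"
  have "nearness x = nearness y" using nearness_le_spike_dist[of x y] 0 by simp
  then consider "x = y" | "x * y = 1" using nearness_eq_iff by blast
  then show "x = y"
  proof cases
    case 2
    then have pos: "0 < x" "0 < y" using assms by (auto simp: less_le)
    show ?thesis
    proof (cases "\<lfloor>x\<rfloor> = \<lfloor>y\<rfloor>")
      case True
      consider "x < 1 \<and> y < 1" | "1 \<le> x \<and> 1 \<le> y" using True floor_less_one[of x] floor_less_one[of y] by (metis not_less)
      then show ?thesis
      proof cases
        case 1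
        then have "x * y < 1 * 1" using pos by (intro mult_strict_mono) auto
        then show ?thesis using 2 by simp
      next
        case ge: 2
        have "x * 1 \<le> x * y" "1 * y \<le> x * y" using ge pos by (auto intro: mult_mono)
        then show ?thesis using ge 2 by simp
      qed
    next
      case False
      then have "elevation x + elevation y = 0"
        using 0 elevation_nonneg[of x] elevation_nonneg[of y] by (auto simp: spike_dist_def)
      then have "elevation x = 0" "elevation y = 0"
        using elevation_nonneg[of x] elevation_nonneg[of y] by linarith+
      then have "x \<in> \<int>" "y \<in> \<int>"
        using pos by (auto simp: elevation_def infdist_Ints_eq_zero_iff)
      then obtain i j where "x = of_int i" "y = of_int j" by (auto elim!: Ints_cases)
      moreover have "1 \<le> i" "1 \<le> j" using pos calculation by auto
      moreover have "i * j = 1" using 2 calculation by (metis of_int_eq_1_iff of_int_mult)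
      ultimately show ?thesis using zmult_eq_1_iff[of i j] by simp
    qed
  qed simp
qed simp

section \<open>Spike convergence compared with ordinary convergence\<close>

lemma spike_dist_tendsto_zero:
  assumes u: "(u \<longlongrightarrow> x) F"
  shows "((\<lambda>z. spike_dist (u z) x) \<longlongrightarrow> 0) F"
proof -
  have le: "\<forall>\<^sub>F z in F. norm (spike_dist (u z) x) \<le>
      \<bar>nearness (u z) - nearness x\<bar> + \<bar>elevation (u z) - elevation x\<bar>"
  proof (cases "x \<in> \<int>")
    \<comment> \<open>The floor differs on the two sides of an integer, but
      \<open>elevation x = 0\<close> makes both branches of the metric coincide.\<close>
    case True
    then have "elevation x = 0" by (simp add: elevation_def)
    then show ?thesis
      by (intro always_eventually allI) (simp add: spike_dist_def elevation_nonneg)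
  next
    case False
    have "of_int \<lfloor>x\<rfloor> \<noteq> x" using False by (metis Ints_of_int)
    then have "of_int \<lfloor>x\<rfloor> < x" "x < of_int \<lfloor>x\<rfloor> + 1" by linarith+
    then have "\<forall>\<^sub>F z in F. of_int \<lfloor>x\<rfloor> < u z" "\<forall>\<^sub>F z in F. u z < of_int \<lfloor>x\<rfloor> + 1"
      using u order_tendsto_iff by blast+
    then show ?thesis
    proof eventually_elim
      case (elim z)
      then have "\<lfloor>u z\<rfloor> = \<lfloor>x\<rfloor>" by (simp add: floor_eq_iff)
      then show ?case by (simp add: spike_dist_def)
    qed
  qed
  have "((\<lambda>z. \<bar>nearness (u z) - nearness x\<bar> + \<bar>elevation (u z) - elevation x\<bar>) \<longlongrightarrow>
      \<bar>nearness x - nearness x\<bar> + \<bar>elevation x - elevation x\<bar>) F"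
    by (intro tendsto_intros tendsto_nearness tendsto_elevation u)
  then show ?thesis using Lim_null_comparison[OF le] by simp
qed

lemma continuous_on_spike_dist: "continuous_on A (\<lambda>y. spike_dist y x)"
  unfolding continuous_on_def
proof (intro ballI)
  fix y
  have "((\<lambda>z. spike_dist z y) \<longlongrightarrow> 0) (at y within A)"
    by (intro spike_dist_tendsto_zero tendsto_ident_at)
  moreover have "\<forall>\<^sub>F z in at y within A. norm (spike_dist z x - spike_dist y x) \<le> spike_dist z y"
  proof (intro always_eventually allI)
    fix z
    show "norm (spike_dist z x - spike_dist y x) \<le> spike_dist z y"
      using spike_dist_triangle[of z x y] spike_dist_triangle[of y x z]
        spike_dist_commute[of y z] by simp
  qed
  ultimately have "((\<lambda>z. spike_dist z x - spike_dist y x) \<longlongrightarrow> 0) (at y within A)"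
    by (rule Lim_null_comparison[rotated])
  then show "((\<lambda>y. spike_dist y x) \<longlongrightarrow> spike_dist y x) (at y within A)"
    by (simp add: LIM_zero_iff)
qed

text \<open>False at \<open>x = 0\<close>, where the integers converge. For \<open>x > 0\<close>, a
  lower bound on nearness confines \<open>u\<close> to a compact interval, and outside a ball around
  \<open>x\<close> the continuous spike distance to \<open>x\<close> has a positive minimum
  there.\<close>

lemma tendsto_if_spike_dist_tendsto_zero:
  assumes u: "((\<lambda>z. spike_dist (u z) x) \<longlongrightarrow> 0) F"
    and nonneg: "\<forall>\<^sub>F z in F. 0 \<le> u z" and x: "0 < x"
  shows "(u \<longlongrightarrow> x) F"
proof (rule tendstoI)
  fix e :: real assume "0 < e"
  define g where "g = nearness x"
  have g: "0 < g" using x by (simp add: g_def nearness_def add_pos_nonneg)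
  define K where "K = {0..2 / g} - ball x e"
  have "compact K" unfolding K_def by (intro compact_diff) auto
  have "\<exists>\<delta>>0. \<forall>y\<in>K. \<delta> \<le> spike_dist y x"
  proof (cases "K = {}")
    case False
    have "continuous_on K (\<lambda>y. spike_dist y x)"
      by (rule continuous_on_spike_dist)
    then obtain y0 where y0: "y0 \<in> K" "\<And>y. y \<in> K \<Longrightarrow> spike_dist y0 x \<le> spike_dist y x"
      using continuous_attains_inf[OF \<open>compact K\<close> False] by blast
    have "0 \<le> y0" "y0 \<noteq> x" using y0(1) \<open>0 < e\<close> by (auto simp: K_def)
    then have "0 < spike_dist y0 x"
      using spike_dist_eq_zero_iff[of y0 x] spike_dist_nonneg[of y0 x] x by (simp add: less_le)
    then show ?thesis using y0(2) by blast
  qed (auto intro: exI[of _ 1])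
  then obtain \<delta> where \<delta>: "0 < \<delta>" "\<And>y. y \<in> K \<Longrightarrow> \<delta> \<le> spike_dist y x" by blast
  have "\<forall>\<^sub>F z in F. spike_dist (u z) x < min \<delta> (g / 2)"
    using order_tendstoD(2)[OF u, of "min \<delta> (g / 2)"] \<delta>(1) g by simp
  with nonneg show "\<forall>\<^sub>F z in F. dist (u z) x < e"
  proof eventually_elim
    case (elim z)
    have "g / 2 < nearness (u z)"
      using nearness_le_spike_dist[of "u z" x] elim x unfolding g_def by (simp add: abs_le_iff)
    moreover have "0 < u z" using calculation g elim by (auto simp: nearness_def less_le)
    ultimately have "g / 2 < 1 / u z" using nearness_le_inverse[of "u z"] by simp
    then have "u z \<le> 2 / g" using \<open>0 < u z\<close> g by (simp add: field_simps)
    moreover have "u z \<notin> K" using \<delta>(2) elim by force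
    ultimately show ?case using elim by (simp add: K_def dist_commute)
  qed
qed

text \<open>Continuity at \<open>0\<close>, the one point whose neighbourhoods are not the ordinary
  ones. Above the barrier a point moves by at most \<open>1\<close> and not away from the integers,
  so nearness and elevation at most double. Below it, the image is within \<open>2 * x\<close> of
  \<open>0\<close>, while \<open>nearness x\<close> is at least
  \<open>x / (1 + b\<^sup>2)\<close>.\<close>

lemma spike_dist_flow_zero_le:
  assumes "0 \<le> s" "s \<le> t" "0 \<le> x"
  shows "spike_dist (flow k s t x) 0 \<le> 2 * (1 + (real (blk (Suc k)))\<^sup>2) * spike_dist x 0"
proof -
  define b where "b = real (blk (Suc k))"
  define y where "y = flow k s t x"
  have "5 \<le> b" using blk_mono[of 1 "Suc k"] by (simp add: b_def)
  have y: "0 \<le> y" using flow_nonneg assms by (simp add: y_def)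
  have d: "spike_dist x 0 = nearness x + elevation x" "spike_dist y 0 = nearness y + elevation y"
    using assms y by (simp_all add: spike_dist_zero)
  have inf1: "infdist z \<int> \<le> 1" for z :: real
    unfolding infdist_Ints using frac_lt_1[of z] by simp
  show ?thesis
  proof (cases "b \<le> x")
    case True
    have y_eq: "y = spread (exp (t - s)) x" using True by (simp add: y_def b_def flow_eq_spread)
    have y2: "x - 1 \<le> y" "y \<le> x + 1"
      using spread_floor_le[of x "exp (t - s)"] spread_le[of "exp (t - s)" x]
      unfolding y_eq by linarith+
    have y3: "infdist y \<int> \<le> infdist x \<int>" unfolding y_eq by (rule infdist_spread_le)
    have "elevation y \<le> (2 * x) * infdist x \<int>" unfolding elevation_def
      using y2 y3 y True \<open>5 \<le> b\<close> by (intro mult_mono) (auto simp: infdist_nonneg)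
    then have h: "elevation y \<le> 2 * elevation x" using True \<open>5 \<le> b\<close> by (simp add: elevation_def)
    have x5: "5 \<le> x" using True \<open>5 \<le> b\<close> by simp
    have "nearness y \<le> 1 / y" using nearness_le_inverse y2 x5 by simp
    also have "\<dots> \<le> 1 / (x - 1)" using y2 x5 by (simp add: frac_le)
    also have "\<dots> \<le> 2 * nearness x"
    proof -
      have "5 * x \<le> x * x" using x5 by (intro mult_right_mono) auto
      then have "1 + x * 2 \<le> x * x" using x5 by linarith
      then have "1 + x\<^sup>2 \<le> 2 * x * (x - 1)" by (simp add: power2_eq_square algebra_simps)
      moreover have "0 < 1 + x\<^sup>2" by (simp add: add_pos_nonneg)
      ultimately have "1 \<le> 2 * x * (x - 1) / (1 + x\<^sup>2)" by (simp only: pos_le_divide_eq mult_1)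
      also have "\<dots> = 2 * nearness x * (x - 1)" by (simp add: nearness_def)
      finally show ?thesis using x5 by (simp only: pos_divide_le_eq diff_gt_0_iff_gt)
    qed
    finally have "spike_dist y 0 \<le> 2 * spike_dist x 0" using h d by simp
    also have "\<dots> \<le> 2 * (1 + b\<^sup>2) * spike_dist x 0"
      using spike_dist_nonneg assms by (intro mult_right_mono) auto
    finally show ?thesis by (simp add: y_def b_def)
  next
    case False
    then have "y \<le> x" using flow_le assms by (simp add: y_def b_def)
    have "elevation y \<le> x * 1" unfolding elevation_def
      using \<open>y \<le> x\<close> y inf1 by (intro mult_mono) (auto simp: infdist_nonneg)
    then have "spike_dist y 0 \<le> 2 * x" using nearness_le[OF y] \<open>y \<le> x\<close> d by simp
    also have "x \<le> (1 + b\<^sup>2) * nearness x"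
    proof -
      have "x\<^sup>2 \<le> b\<^sup>2" using False assms by (intro power_mono) auto
      then have "x * (1 + x\<^sup>2) \<le> x * (1 + b\<^sup>2)" using assms by (intro mult_left_mono) auto
      moreover have "0 < 1 + x\<^sup>2" by (simp add: add_pos_nonneg)
      ultimately have "x \<le> x * (1 + b\<^sup>2) / (1 + x\<^sup>2)" by (simp add: pos_le_divide_eq)
      then show ?thesis by (simp add: nearness_def mult.commute)
    qed
    also have "(1 + b\<^sup>2) * nearness x \<le> (1 + b\<^sup>2) * spike_dist x 0"
      using d elevation_nonneg assms by (intro mult_left_mono) auto
    finally show ?thesis by (simp only: y_def b_def mult.assoc)
  qed
qed

lemma spike_dist_flow_tendsto_zero:
  assumes s: "(s \<longlongrightarrow> s0) F" and t: "(t \<longlongrightarrow> t0) F"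
    and u: "((\<lambda>z. spike_dist (u z) x) \<longlongrightarrow> 0) F"
    and ev: "\<forall>\<^sub>F z in F. 0 \<le> s z \<and> s z \<le> t z \<and> 0 \<le> u z"
    and s0: "0 \<le> s0" "s0 \<le> t0" and x: "0 \<le> x"
  shows "((\<lambda>z. spike_dist (flow k (s z) (t z) (u z)) (flow k s0 t0 x)) \<longlongrightarrow> 0) F"
proof (cases "x = 0")
  case True
  define C where "C = 2 * (1 + (real (blk (Suc k)))\<^sup>2)"
  have "\<forall>\<^sub>F z in F. norm (spike_dist (flow k (s z) (t z) (u z)) 0) \<le> C * spike_dist (u z) 0"
    using ev
  proof eventually_elim
    case (elim z)
    then show ?case
      using spike_dist_flow_zero_le[of "s z" "t z" "u z" k] by (simp add: C_def)
  qed
  moreover have "((\<lambda>z. C * spike_dist (u z) 0) \<longlongrightarrow> 0) F"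
    by (rule tendsto_mult_right_zero) (use u True in simp)
  ultimately have "((\<lambda>z. spike_dist (flow k (s z) (t z) (u z)) 0) \<longlongrightarrow> 0) F"
    by (rule Lim_null_comparison)
  then show ?thesis using True s0 by simp
next
  case False
  have "\<forall>\<^sub>F z in F. 0 \<le> u z" using ev by eventually_elim simp
  moreover have "0 < x" using False x by simp
  ultimately have "(u \<longlongrightarrow> x) F" by (rule tendsto_if_spike_dist_tendsto_zero[OF u])
  then show ?thesis by (intro spike_dist_tendsto_zero tendsto_flow s t s0)
qed

subsection \<open>The state space\<close>

text \<open>Constant sequences embed the half-line into the prescribed type of points.\<close>

definition point :: "real \<Rightarrow> nat \<Rightarrow> real" where
  "point x = (\<lambda>_. x)"

definition spike_space :: "(nat \<Rightarrow> real) metric" where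
  "spike_space = metric (point ` {0..}, \<lambda>f g. spike_dist (f 0) (g 0))"

lemma point_zero [simp]: "point x 0 = x"
  by (simp add: point_def)

interpretation spike: Metric_space "point ` {0..}" "\<lambda>f g. spike_dist (f 0) (g 0)"
  by unfold_locales
    (auto simp: spike_dist_nonneg spike_dist_triangle spike_dist_eq_zero_iff intro: spike_dist_commute)

lemma mspace_spike_space [simp]: "mspace spike_space = point ` {0..}"
  and mdist_spike_space [simp]: "mdist spike_space f g = spike_dist (f 0) (g 0)"
  and mtopology_of_spike_space: "mtopology_of spike_space = spike.mtopology"
  by (simp_all add: spike_space_def)

lemma limitin_spike_iff:
  "limitin (mtopology_of spike_space) f l F \<longleftrightarrow> l \<in> point ` {0..} \<and>
    (\<forall>\<^sub>F z in F. f z \<in> point ` {0..}) \<and> ((\<lambda>z. spike_dist (f z 0) (l 0)) \<longlongrightarrow> 0) F"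
  unfolding mtopology_of_spike_space by (rule spike.limitin_metric_dist_null)

text \<open>The ordinary topology is finer than the spike topology, so path-connectedness and
  separability pass to the spike space.\<close>

lemma continuous_map_point: "continuous_map (top_of_set {0..}) (mtopology_of spike_space) point"
  unfolding continuous_map_atin limitin_spike_iff
proof (intro ballI conjI)
  fix x :: real assume "x \<in> topspace (top_of_set {0..})"
  then have x: "0 \<le> x" by simp
  then show "point x \<in> point ` {0..}" by simp
  have at: "atin (top_of_set {0..}) x = at x within {0..}"
    using x by (auto simp: atin_subtopology_within filter_eq_iff eventually_atin_within
        eventually_at_topological)
  show "\<forall>\<^sub>F z in atin (top_of_set {0..}) x. point z \<in> point ` {0..}"
    unfolding at by (auto simp: eventually_at_filter)
  show "((\<lambda>z. spike_dist (point z 0) (point x 0)) \<longlongrightarrow> 0) (atin (top_of_set {0..}) x)"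
    unfolding at point_zero by (intro spike_dist_tendsto_zero tendsto_ident_at)
qed

lemma path_connected_spike_space: "path_connected_space (mtopology_of spike_space)"
proof -
  have "path_connectedin (top_of_set {0..}) {0::real..}"
    by (simp add: path_connectedin_subtopology convex_imp_path_connected)
  then have "path_connectedin (mtopology_of spike_space) (point ` {0..})"
    by (rule path_connectedin_continuous_map_image[OF continuous_map_point])
  then show ?thesis by (simp flip: path_connectedin_topspace)
qed

lemma polish_spike_space: "polish_metric spike_space"
  unfolding polish_metric_def
proof
  obtain C :: "real set" where C: "countable C" "C \<subseteq> {0..}" "{0..} \<subseteq> closure C"
    by (rule separable)
  have "separable_space (top_of_set {0::real..})"
    unfolding separable_space_def
  proof (intro exI conjI)
    show "top_of_set {0..} closure_of C = topspace (top_of_set {0..})"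
      using C by (auto simp: closure_of_subtopology Int_absorb1)
  qed (use C in auto)
  then show "separable_space (mtopology_of spike_space)"
    by (rule separable_space_continuous_map_image[OF _ continuous_map_point]) simp
  have "spike.mcomplete"
    unfolding spike.mcomplete_def
  proof (intro allI impI)
    fix \<sigma> assume Cauchy: "spike.MCauchy \<sigma>"
    define u where "u n = \<sigma> n 0" for n
    have "range \<sigma> \<subseteq> point ` {0..}" using Cauchy by (simp add: spike.MCauchy_def)
    then have \<sigma>: "\<sigma> n = point (u n)" and u: "0 \<le> u n" for n
      by (auto simp: u_def image_subset_iff) (metis image_iff point_zero atLeast_iff)+
    have lim: "limitin spike.mtopology (\<sigma> \<circ> s) (point l) sequentially"
      if "0 \<le> l" "(\<lambda>n. spike_dist (u (s n)) l) \<longlonglongrightarrow> 0" for l and s :: "nat \<Rightarrow> nat"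
      using that u limitin_spike_iff[of "\<sigma> \<circ> s" "point l" sequentially]
      by (simp add: \<sigma> mtopology_of_spike_space)
    show "\<exists>x. limitin spike.mtopology \<sigma> x sequentially"
    proof (cases "\<exists>M. infinite {n. u n \<le> M}")
      case True
      then obtain M where "infinite {n. u n \<le> M}" by blast
      then obtain r :: "nat \<Rightarrow> nat" where r: "strict_mono r" "\<And>n. u (r n) \<le> M"
        using infinite_enumerate by (metis mem_Collect_eq)
      have "\<forall>n. (u \<circ> r) n \<in> {0..M}" using u r(2) by simp
      then obtain l q where l: "l \<in> {0..M}" "strict_mono q" "(u \<circ> r \<circ> q) \<longlonglongrightarrow> l"
        using compact_Icc[of 0 M] unfolding compact_def by meson
      have "(\<lambda>n. spike_dist (u ((r \<circ> q) n)) l) \<longlonglongrightarrow> 0"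
        using spike_dist_tendsto_zero[OF l(3)] by simp
      then have "limitin spike.mtopology (\<sigma> \<circ> (r \<circ> q)) (point l) sequentially"
        using l(1) by (intro lim) auto
      then show ?thesis
        using spike.MCauchy_convergent_subsequence[OF Cauchy] r(1) l(2) strict_mono_o by blast
    next
      \<comment> \<open>The sequence escapes to infinity. Compared with a later term in another
        cell, elevations add, so the Cauchy property makes the elevation small; nearness is small
        far out. The limit is therefore \<open>0\<close>.\<close>
      case False
      have large: "\<exists>N. \<forall>n\<ge>N. M < u n" for M
      proof -
        obtain N where "\<forall>n\<in>{n. u n \<le> M}. n < N"
          using False finite_nat_set_iff_bounded by blast
        then show ?thesis by (intro exI[of _ N]) (auto simp: not_le[symmetric])
      qed
      have "(\<lambda>n. spike_dist (u n) 0) \<longlonglongrightarrow> 0"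
      proof (rule LIMSEQ_I)
        fix e :: real assume e: "0 < e"
        then obtain N where N: "\<And>n n'. N \<le> n \<Longrightarrow> N \<le> n' \<Longrightarrow> spike_dist (u n) (u n') < e / 2"
          using Cauchy unfolding spike.MCauchy_def u_def by (meson half_gt_zero)
        obtain N' where N': "\<And>n. N' \<le> n \<Longrightarrow> 2 / e < u n" using large by blast
        have "norm (spike_dist (u n) 0 - 0) < e" if n: "max N N' \<le> n" for n
        proof -
          obtain N'' where N'': "\<And>m. N'' \<le> m \<Longrightarrow> u n + 1 < u m" using large by blast
          define m where "m = max N N''"
          have "\<lfloor>u n\<rfloor> \<noteq> \<lfloor>u m\<rfloor>" using N''[of m] unfolding m_def by linarith
          then have "elevation (u n) \<le> spike_dist (u n) (u m)"
            using elevation_nonneg[of "u m"] by (simp add: spike_dist_def)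
          also have "\<dots> < e / 2" using N n by (simp add: m_def)
          finally have 1: "elevation (u n) < e / 2" .
          have un: "2 / e < u n" "0 < 2 / e" using N' n e by auto
          then have "nearness (u n) \<le> 1 / u n" by (intro nearness_le_inverse) linarith
          also have "\<dots> < 1 / (2 / e)" using un
            by (intro divide_strict_left_mono mult_pos_pos) linarith+
          finally have "nearness (u n) < e / 2" by simp
          then show ?thesis using 1 spike_dist_zero[OF u, of n] spike_dist_nonneg[of "u n" 0] by simp
        qed
        then show "\<exists>no. \<forall>n\<ge>no. norm (spike_dist (u n) 0 - 0) < e" by blast
      qed
      then have "limitin spike.mtopology (\<sigma> \<circ> id) (point 0) sequentially" by (intro lim) auto
      then show ?thesis by auto
    qed
  qed
  then show "mcomplete_of spike_space" by (simp add: mcomplete_of_def spike_space_def)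
qed

section \<open>Borel sets of the spike space\<close>

lemma continuous_map_point_max:
  "continuous_map euclidean (mtopology_of spike_space) (\<lambda>x. point (max 0 x))"
proof -
  have "continuous_map euclidean (top_of_set {0..}) (\<lambda>x::real. max 0 x)"
    by (simp add: continuous_map_in_subtopology) (intro continuous_intros)
  from continuous_map_compose[OF this continuous_map_point] show ?thesis by (simp add: o_def)
qed

lemma space_borel_of_metric [simp]: "space (borel_of_metric X) = mspace X"
  by (auto simp: borel_of_metric_def space_measure_of_conv)

lemma openin_in_sets_borel_of_metric:
  "openin (mtopology_of X) U \<Longrightarrow> U \<in> sets (borel_of_metric X)"
  unfolding borel_of_metric_def
  by (subst sets_measure_of) (use openin_subset[of "mtopology_of X"] in auto)

lemma measurable_borel_of_metricI:
  assumes "f \<in> space M \<rightarrow> mspace X"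
    and "\<And>U. openin (mtopology_of X) U \<Longrightarrow> f -` U \<inter> space M \<in> sets M"
  shows "f \<in> M \<rightarrow>\<^sub>M borel_of_metric X"
  unfolding borel_of_metric_def
  by (rule measurable_measure_of) (use assms openin_subset[of "mtopology_of X"] in auto)

lemma measurable_point: "(\<lambda>x. point (max 0 x)) \<in> borel \<rightarrow>\<^sub>M borel_of_metric spike_space"
proof (rule measurable_borel_of_metricI)
  fix U assume "openin (mtopology_of spike_space) U"
  then have "open {x. point (max 0 x) \<in> U}"
    using openin_continuous_map_preimage[OF continuous_map_point_max] by simp
  then show "(\<lambda>x. point (max 0 x)) -` U \<inter> space borel \<in> sets borel"
    by (simp add: vimage_def)
qed auto

text \<open>The complement is a compact interval in the ordinary sense, hence at positive spike
  distance. For \<open>a > 0\<close> the sets \<open>f 0 < a\<close> are not open, since large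
  integers are near \<open>0\<close>, but the upper half-lines already generate the Borel
  sets.\<close>

lemma openin_spike_greater:
  assumes "0 \<le> a"
  shows "openin (mtopology_of spike_space) {f \<in> point ` {0..}. a < f 0}"
  unfolding mtopology_of_spike_space spike.openin_mtopology
proof (intro conjI allI impI)
  fix f assume f: "f \<in> {f \<in> point ` {0..}. a < f 0}"
  define x where "x = f 0"
  have x: "a < x" "f = point x" using f by (auto simp: x_def)
  define C where "C = {0..a}"
  have "\<exists>y\<in>C. \<forall>z\<in>C. spike_dist y x \<le> spike_dist z x"
    by (rule continuous_attains_inf) (use assms in \<open>auto simp: C_def intro: continuous_on_spike_dist\<close>)
  then obtain y where y: "y \<in> C" "\<And>z. z \<in> C \<Longrightarrow> spike_dist y x \<le> spike_dist z x" by blast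
  have "y \<noteq> x" "0 \<le> y" using y x by (auto simp: C_def)
  then have "0 < spike_dist y x"
    using spike_dist_eq_zero_iff[of y x] spike_dist_nonneg[of y x] x assms by (simp add: less_le)
  moreover have "spike.mball f (spike_dist y x) \<subseteq> {f \<in> point ` {0..}. a < f 0}"
  proof
    fix g assume g: "g \<in> spike.mball f (spike_dist y x)"
    then have "g \<in> point ` {0..}" "spike_dist (f 0) (g 0) < spike_dist y x" by auto
    moreover have "g 0 \<notin> C"
      using calculation(2) y(2)[of "g 0"] spike_dist_commute[of "g 0" x] by (auto simp: x_def)
    ultimately show "g \<in> {f \<in> point ` {0..}. a < f 0}" by (auto simp: C_def)
  qed
  ultimately show "\<exists>r>0. spike.mball f r \<subseteq> {f \<in> point ` {0..}. a < f 0}" by blast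
qed auto

lemma measurable_coordinate: "(\<lambda>f. f 0) \<in> borel_measurable (borel_of_metric spike_space)"
  unfolding borel_measurable_iff_greater
proof
  fix a :: real
  show "{f \<in> space (borel_of_metric spike_space). a < f 0} \<in> sets (borel_of_metric spike_space)"
  proof (cases "0 \<le> a")
    case True
    then show ?thesis
      using openin_in_sets_borel_of_metric[OF openin_spike_greater[OF True]] by simp
  next
    case False
    then have "{f \<in> space (borel_of_metric spike_space). a < f 0} = space (borel_of_metric spike_space)"
      by auto
    then show ?thesis by (simp only: sets.top)
  qed
qed

text \<open>An open set around \<open>0\<close> contains all integers from some \<open>N\<close> on,
  which leaves finitely many points to cover.\<close>

lemma compactin_point_of_nat:
  assumes "0 \<in> S"
  shows "compactin (mtopology_of spike_space) ((\<lambda>n. point (real n)) ` S)"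
  unfolding compactin_def
proof (intro conjI allI impI)
  fix \<U> assume \<U>: "(\<forall>U\<in>\<U>. openin (mtopology_of spike_space) U) \<and> (\<lambda>n. point (real n)) ` S \<subseteq> \<Union>\<U>"
  then obtain U where U: "U \<in> \<U>" "point 0 \<in> U" "openin spike.mtopology U"
    using assms by (force simp: mtopology_of_spike_space)
  then obtain e where e: "0 < e" "spike.mball (point 0) e \<subseteq> U"
    unfolding spike.openin_mtopology by blast
  obtain N :: nat where N: "1 / e < real N" using reals_Archimedean2 by blast
  have in_U: "point (real n) \<in> U" if "N \<le> n" for n
  proof -
    have "1 / e < real n" "0 < 1 / e" using N that e by auto
    then have "nearness (real n) \<le> 1 / real n" by (intro nearness_le_inverse) linarith
    also have "\<dots> < 1 / (1 / e)" using \<open>1 / e < real n\<close> \<open>0 < 1 / e\<close>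
      by (intro divide_strict_left_mono mult_pos_pos) linarith+
    finally have "point (real n) \<in> spike.mball (point 0) e"
      by (simp add: spike_dist_commute[of 0] spike_dist_zero)
    then show ?thesis using e(2) by blast
  qed
  have "\<forall>n\<in>S. \<exists>V\<in>\<U>. point (real n) \<in> V" using \<U> by blast
  then obtain V where V: "\<And>n. n \<in> S \<Longrightarrow> V n \<in> \<U> \<and> point (real n) \<in> V n" by metis
  show "\<exists>\<F>. finite \<F> \<and> \<F> \<subseteq> \<U> \<and> (\<lambda>n. point (real n)) ` S \<subseteq> \<Union>\<F>"
    using U(1) V in_U
    by (intro exI[of _ "insert U (V ` (S \<inter> {..<N}))"]) (auto simp: not_less[symmetric])
qed auto

text \<open>Boundedness is used only as a bound on elevation, which forces the large elements to be
  close to integers.\<close>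

lemma bounded_spike_space:
  assumes "bounded_in_metric spike_space B"
  obtains R where "B \<subseteq> point ` {0..}" "\<And>f. f \<in> B \<Longrightarrow> elevation (f 0) \<le> R"
proof -
  from assms obtain g r where B: "B \<subseteq> spike.mcball g r"
    by (auto simp: spike.mbounded_def spike_space_def)
  show thesis
  proof (rule that)
    show "B \<subseteq> point ` {0..}" using B by auto
    fix f assume "f \<in> B"
    then have "spike_dist (g 0) (f 0) \<le> r" using B by auto
    then show "elevation (f 0) \<le> elevation (g 0) + r"
      using elevation_le_spike_dist[of "g 0" "f 0"] by linarith
  qed
qed

subsection \<open>Evolutions driven by a sequence of levels\<close>

definition clamp01 :: "real \<Rightarrow> real" where
  "clamp01 t = max 0 (min 1 t)"

lemma clamp01_mono: "s \<le> t \<Longrightarrow> clamp01 s \<le> clamp01 t"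
  and clamp01_nonneg [simp]: "0 \<le> clamp01 t"
  and clamp01_eq_0: "t \<le> 0 \<Longrightarrow> clamp01 t = 0"
  and clamp01_eq_1: "1 \<le> t \<Longrightarrow> clamp01 t = 1"
  by (auto simp: clamp01_def)

lemma tendsto_clamp01: "(f \<longlongrightarrow> a) F \<Longrightarrow> ((\<lambda>z. clamp01 (f z)) \<longlongrightarrow> clamp01 a) F"
  unfolding clamp01_def by (intro tendsto_intros)

text \<open>By clamping, a factor whose unit interval does not meet the time from \<open>s\<close>
  to \<open>t\<close> is the identity. One product over a long range thus serves all start and end
  times within it, which yields continuity across integer times.\<close>

primrec steps :: "(int \<Rightarrow> nat) \<Rightarrow> int \<Rightarrow> nat \<Rightarrow> real \<Rightarrow> real \<Rightarrow> real \<Rightarrow> real" where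
  "steps l i 0 s t x = x"
| "steps l i (Suc m) s t x = flow (l (i + int m))
     (clamp01 (s - of_int (i + int m))) (clamp01 (t - of_int (i + int m))) (steps l i m s t x)"

lemma steps_nonneg: "0 \<le> x \<Longrightarrow> 0 \<le> steps l i m s t x"
  by (induction m) (auto intro: flow_nonneg)

lemma steps_le_of_nat: "s \<le> t \<Longrightarrow> 0 \<le> x \<Longrightarrow> x \<le> real n \<Longrightarrow> steps l i m s t x \<le> real n"
  by (induction m) (auto intro!: flow_le_of_nat clamp01_mono steps_nonneg)

lemma steps_refl: "0 \<le> x \<Longrightarrow> steps l i m s s x = x"
  by (induction m) (auto simp: flow_refl)

lemma steps_before: "s \<le> t \<Longrightarrow> t \<le> of_int i \<Longrightarrow> 0 \<le> x \<Longrightarrow> steps l i m s t x = x"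
  by (induction m) (auto simp: flow_refl clamp01_eq_0)

lemma steps_after: "s \<le> t \<Longrightarrow> of_int i + real m \<le> s \<Longrightarrow> 0 \<le> x \<Longrightarrow> steps l i m s t x = x"
  by (induction m) (auto simp: flow_refl clamp01_eq_1)

lemma steps_shift:
  "steps (\<lambda>j. l (j + c)) i m s t x = steps l (i + c) m (s + of_int c) (t + of_int c) x"
  by (induction m) (auto simp: algebra_simps)

lemma steps_add: "steps l i (m + m') s t x = steps l (i + int m) m' s t (steps l i m s t x)"
  by (induction m') (auto simp: algebra_simps)

lemma steps_comp:
  assumes "s \<le> t" "t \<le> u" "0 \<le> x"
  shows "steps l i m t u (steps l i m s t x) = steps l i m s u x"
proof (induction m)
  case (Suc m)
  define e where "e s t = flow (l (i + int m)) (clamp01 (s - of_int (i + int m)))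
    (clamp01 (t - of_int (i + int m)))" for s t
  have S: "steps l i (Suc m) s t x = e s t (steps l i m s t x)" for s t x by (simp add: e_def)
  have nn: "0 \<le> steps l i m s t x" "0 \<le> steps l i m s u x" using assms steps_nonneg by auto
  show ?case
  proof (cases "t \<le> of_int (i + int m)")
    case True
    then have e: "e s t y = y" "e t u y = e s u y" if "0 \<le> y" for y
      using assms that by (simp_all add: e_def clamp01_eq_0 flow_refl)
    show ?thesis unfolding S using e nn Suc.IH by simp
  next
    \<comment> \<open>All earlier factors have finished by time \<open>t\<close>; from
      \<open>t\<close> on they are the identity, so only the last factor needs the semiflow
      law.\<close>
    case False
    then have a: "of_int i + real m \<le> t" by simp
    have "steps l i m s u x = steps l i m t u (steps l i m s t x)" using Suc.IH by simp
    also have "\<dots> = steps l i m s t x" using steps_after[OF assms(2) a] nn by simp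
    finally have eq: "steps l i m s u x = steps l i m s t x" .
    have "steps l i m t u y = y" if "0 \<le> y" for y
      using steps_after[OF assms(2) a that] .
    then have "steps l i m t u (e s t (steps l i m s t x)) = e s t (steps l i m s t x)"
      using nn flow_nonneg by (simp add: e_def)
    moreover have "e t u (e s t y) = e s u y" if "0 \<le> y" for y
      unfolding e_def using assms that by (intro flow_flow clamp01_mono) auto
    ultimately show ?thesis unfolding S using nn eq by simp
  qed
qed simp

definition evolve :: "(int \<Rightarrow> nat) \<Rightarrow> real \<Rightarrow> real \<Rightarrow> real \<Rightarrow> real" where
  "evolve l s t = steps l \<lfloor>s\<rfloor> (nat (\<lceil>t\<rceil> - \<lfloor>s\<rfloor>)) s t"

lemma evolve_eq_steps:
  assumes "s \<le> t" "of_int i \<le> s" "t \<le> of_int i + real m" "0 \<le> x"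
  shows "evolve l s t x = steps l i m s t x"
proof -
  define a b c where "a = nat (\<lfloor>s\<rfloor> - i)" and "b = nat (\<lceil>t\<rceil> - \<lfloor>s\<rfloor>)" and "c = nat (i + int m - \<lceil>t\<rceil>)"
  have st: "\<lfloor>s\<rfloor> \<le> \<lceil>t\<rceil>" using assms by (meson floor_mono floor_le_ceiling order_trans)
  have "i \<le> \<lfloor>s\<rfloor>" using assms by (simp add: le_floor_iff)
  moreover have "\<lceil>t\<rceil> \<le> i + int m" using assms by (simp add: ceiling_le_iff)
  ultimately have m: "m = a + (b + c)" and ia: "i + int a = \<lfloor>s\<rfloor>" and ib: "\<lfloor>s\<rfloor> + int b = \<lceil>t\<rceil>"
    using st by (auto simp: a_def b_def c_def)
  have "real_of_int (i + int a) \<le> s" unfolding ia by simp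
  then have "steps l i a s t x = x" using assms by (intro steps_after) auto
  then have "steps l i m s t x = steps l (\<lfloor>s\<rfloor> + int b) c s t (steps l \<lfloor>s\<rfloor> b s t x)"
    by (simp add: m steps_add ia)
  also have "\<dots> = steps l \<lfloor>s\<rfloor> b s t x"
    unfolding ib using assms by (intro steps_before steps_nonneg) auto
  finally show ?thesis by (simp add: evolve_def b_def)
qed

lemma evolve_nonneg: "0 \<le> x \<Longrightarrow> 0 \<le> evolve l s t x"
  by (simp add: evolve_def steps_nonneg)

lemma evolve_le_of_nat: "s \<le> t \<Longrightarrow> 0 \<le> x \<Longrightarrow> x \<le> real n \<Longrightarrow> evolve l s t x \<le> real n"
  unfolding evolve_def by (rule steps_le_of_nat)

lemma evolve_zero [simp]: "s \<le> t \<Longrightarrow> evolve l s t 0 = 0"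
  using evolve_le_of_nat[of s t 0 0 l] evolve_nonneg[of 0 l s t] by simp

lemma evolve_refl: "0 \<le> x \<Longrightarrow> evolve l s s x = x"
  by (simp add: evolve_def steps_refl)

lemma evolve_evolve:
  assumes "s \<le> t" "t \<le> u" "0 \<le> x"
  shows "evolve l t u (evolve l s t x) = evolve l s u x"
proof -
  define m where "m = nat (\<lceil>u\<rceil> - \<lfloor>s\<rfloor>)"
  have "\<lfloor>s\<rfloor> \<le> \<lceil>u\<rceil>" using assms by (meson floor_mono floor_le_ceiling order_trans)
  then have "of_int \<lfloor>s\<rfloor> + real m = of_int \<lceil>u\<rceil>" by (simp add: m_def)
  then have u: "u \<le> of_int \<lfloor>s\<rfloor> + real m" by simp
  have s: "of_int \<lfloor>s\<rfloor> \<le> s" by simp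
  show ?thesis
    using evolve_eq_steps[OF assms(1) s _ assms(3), of m l]
      evolve_eq_steps[of t u "\<lfloor>s\<rfloor>" m "steps l \<lfloor>s\<rfloor> m s t x" l]
      evolve_eq_steps[of s u "\<lfloor>s\<rfloor>" m x l] u s assms steps_nonneg[OF assms(3)]
      steps_comp[OF assms, of l "\<lfloor>s\<rfloor>" m] by simp
qed

lemma evolve_shift: "evolve (\<lambda>j. l (j + c)) s t x = evolve l (s + of_int c) (t + of_int c) x"
  by (simp add: evolve_def steps_shift)

lemma evolve_one_level:
  assumes "s \<le> t" "of_int i \<le> s" "t \<le> of_int i + 1" "0 \<le> x"
  shows "evolve l s t x = flow (l i) (s - of_int i) (t - of_int i) x"
proof -
  have "clamp01 (s - of_int i) = s - of_int i" "clamp01 (t - of_int i) = t - of_int i"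
    using assms by (auto simp: clamp01_def)
  then show ?thesis using evolve_eq_steps[of s t i 1 x l] assms by simp
qed

lemma evolve_of_nat:
  "evolve l (of_int i) (of_int i + real m) (real n) = real (jumps l i m n)"
proof (induction m)
  case (Suc m)
  define t where "t = real_of_int (i + int m)"
  have t: "t = of_int i + real m" "of_int i + real (Suc m) = t + 1" by (simp_all add: t_def)
  have "evolve l (of_int i) (t + 1) (real n) = evolve l t (t + 1) (evolve l (of_int i) t (real n))"
    by (rule evolve_evolve[symmetric]) (simp_all add: t_def)
  also have "evolve l (of_int i) t (real n) = real (jumps l i m n)" unfolding t(1) by (rule Suc.IH)
  also have "evolve l t (t + 1) (real (jumps l i m n)) =
      flow (l (i + int m)) (t - of_int (i + int m)) (t + 1 - of_int (i + int m)) (real (jumps l i m n))"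
    by (rule evolve_one_level) (simp_all add: t_def)
  also have "\<dots> = real (jumps l i (Suc m) n)" by (simp add: t_def flow_of_nat)
  finally show ?case unfolding t(2) .
qed (simp add: evolve_refl)

section \<open>Joint continuity of the evolution\<close>

lemma spike_dist_steps_tendsto_zero:
  assumes s: "(s \<longlongrightarrow> s0) F" and t: "(t \<longlongrightarrow> t0) F"
    and u: "((\<lambda>z. spike_dist (u z) x) \<longlongrightarrow> 0) F"
    and ev: "\<forall>\<^sub>F z in F. s z \<le> t z \<and> 0 \<le> u z"
    and "s0 \<le> t0" "0 \<le> x"
  shows "((\<lambda>z. spike_dist (steps l i m (s z) (t z) (u z)) (steps l i m s0 t0 x)) \<longlongrightarrow> 0) F"
proof (induction m)
  case (Suc m)
  have "\<forall>\<^sub>F z in F. 0 \<le> clamp01 (s z - of_int (i + int m)) \<and>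
      clamp01 (s z - of_int (i + int m)) \<le> clamp01 (t z - of_int (i + int m)) \<and>
      0 \<le> steps l i m (s z) (t z) (u z)"
    using ev by eventually_elim (auto intro: clamp01_mono steps_nonneg)
  then show ?case
    unfolding steps.simps
    by (intro spike_dist_flow_tendsto_zero[OF _ _ Suc.IH] tendsto_clamp01 tendsto_diff tendsto_const s t)
      (use assms in \<open>auto intro: clamp01_mono steps_nonneg\<close>)
qed (simp add: u)

lemma spike_dist_evolve_tendsto_zero:
  assumes s: "(s \<longlongrightarrow> s0) F" and t: "(t \<longlongrightarrow> t0) F"
    and u: "((\<lambda>z. spike_dist (u z) x) \<longlongrightarrow> 0) F"
    and ev: "\<forall>\<^sub>F z in F. s z \<le> t z \<and> 0 \<le> u z"
    and st: "s0 \<le> t0" and x: "0 \<le> x"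
  shows "((\<lambda>z. spike_dist (evolve l (s z) (t z) (u z)) (evolve l s0 t0 x)) \<longlongrightarrow> 0) F"
proof -
  \<comment> \<open>One spare interval on each side makes the same product valid for all nearby
    times, also when \<open>s0\<close> or \<open>t0\<close> is an integer.\<close>
  define i where "i = \<lfloor>s0\<rfloor> - 1"
  define m where "m = nat (\<lceil>t0\<rceil> + 1 - i)"
  have "\<lfloor>s0\<rfloor> \<le> \<lceil>t0\<rceil>" using st by (meson floor_mono floor_le_ceiling order_trans)
  then have im: "of_int i + real m = of_int \<lceil>t0\<rceil> + 1" by (simp add: m_def i_def)
  have "of_int i < s0" unfolding i_def by linarith
  have "t0 < of_int i + real m" unfolding im by linarith
  have "\<forall>\<^sub>F z in F. of_int i < s z" using s \<open>of_int i < s0\<close> order_tendstoD by blast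
  moreover have "\<forall>\<^sub>F z in F. t z < of_int i + real m" using t \<open>t0 < _\<close> order_tendstoD by blast
  ultimately have "\<forall>\<^sub>F z in F. spike_dist (steps l i m (s z) (t z) (u z)) (steps l i m s0 t0 x) =
      spike_dist (evolve l (s z) (t z) (u z)) (evolve l s0 t0 x)"
    using ev
  proof eventually_elim
    case (elim z)
    then have "evolve l (s z) (t z) (u z) = steps l i m (s z) (t z) (u z)"
      by (intro evolve_eq_steps) auto
    moreover have "evolve l s0 t0 x = steps l i m s0 t0 x"
      using st x \<open>of_int i < s0\<close> \<open>t0 < _\<close> by (intro evolve_eq_steps) auto
    ultimately show ?case by simp
  qed
  then show ?thesis
    using spike_dist_steps_tendsto_zero[OF s t u ev st x, of l i m] tendsto_cong by fastforce
qed

section \<open>Attraction for a fixed sequence of levels\<close>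

lemma flow_eq_zero:
  assumes "0 \<le> x" "x \<le> real (blk k)"
  shows "flow k 0 1 x = 0"
proof -
  have "2 * real (blk k) < real (blk (Suc k))" "real (blk k) + 1 \<le> real (blk (Suc k))"
    using blk_double_less[of k] by linarith+
  then show ?thesis using assms
    by (subst flow_eq_fwd) (auto simp: fwd_def bwd_def max_def)
qed

text \<open>
  Let \<open>K\<close> be the largest level in the time window.  Points below \<open>blk K\<close> are sent to \<open>0\<close> when level
  \<open>K\<close> occurs.  The other points are integers from time \<open>2\<close> on; such an integer either stays above
  \<open>blk K\<close> or belongs to the ancient integers, since all higher levels lie before the window.
\<close>

lemma evolve_near_ancient:
  assumes l: "recurrent_levels l" and u: "0 \<le> u" "u < 1"
    and T: "real M \<le> T" "T < real M + 1"
    and K0: "1 \<le> K0" "l 0 < K0" "l 1 < K0" "l (int M) < K0" "2 ^ (K0 + 1) + 2 \<le> M"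
    and x: "0 \<le> x" "8 * elevation x \<le> real (blk K0)"
  shows "\<exists>n\<in>ancient l (int M).
    spike_dist (evolve l u T x) (evolve l (real M) T (real n)) \<le> 1 / real (blk K0)"
proof -
  define K where "K = Max (l ` {0..int M})"
  have "K \<in> l ` {0..int M}" unfolding K_def by (intro Max_in) auto
  then obtain j0 where j0: "0 \<le> j0" "j0 \<le> int M" "l j0 = K" by auto
  have le_K: "l j \<le> K" if "0 \<le> j" "j \<le> int M" for j
    unfolding K_def using that by (intro Max_ge) auto
  \<comment> \<open>A recurrence inside the window pushes its largest level above \<open>K0\<close>,
    and so above the levels of the end intervals.\<close>
  obtain j1 where j1: "int M + 1 - 2 ^ (K0 + 1) \<le> j1" "j1 < int M + 1" "K0 < l j1"
    using l unfolding recurrent_levels_def by blast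
  have "int (2 ^ (K0 + 1) + 2) \<le> int M" using K0(5) by (simp only: of_nat_le_iff)
  then have "0 \<le> j1" using j1(1) by simp
  then have "K0 < K" using le_K[of j1] j1 by simp
  \<comment> \<open>A level above \<open>K\<close> can recur only before the window, so the window
    is no longer than the period \<open>2 ^ (K + 1)\<close>.\<close>
  obtain j2 where j2: "int M + 1 - 2 ^ (K + 1) \<le> j2" "j2 < int M + 1" "K < l j2"
    using l unfolding recurrent_levels_def by blast
  have "j2 < 0" using le_K[of j2] j2 by force
  then have "int M \<le> int (2 ^ (K + 1))" using j2(1) by simp
  then have M_le: "M \<le> 2 ^ (K + 1)" by (simp only: of_nat_le_iff)
  have "0 < blk K0" using blk_pos K0 by simp
  have "blk K0 \<le> blk K" using blk_mono \<open>K0 < K\<close> by simp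
  have uT: "u \<le> T" "2 \<le> M" using u T K0(5) by auto
  show ?thesis
  proof (cases "x \<le> real (blk K)")
    case True
    \<comment> \<open>The intervals \<open>0\<close> and \<open>M\<close> are cut by
      \<open>u\<close> and \<open>T\<close>; level \<open>K\<close> avoids them and therefore acts
      for a complete unit of time.\<close>
    have j0': "j0 \<noteq> 0" "j0 \<noteq> int M" using j0 \<open>K0 < K\<close> K0 by auto
    define t where "t = real_of_int j0"
    have t: "u \<le> t" "t + 1 \<le> T" using j0 j0' u T by (auto simp: t_def)
    define y where "y = evolve l u t x"
    have y: "0 \<le> y" "y \<le> real (blk K)"
      using evolve_nonneg evolve_le_of_nat t x True by (auto simp: y_def)
    have "evolve l t (t + 1) y = flow (l j0) (t - of_int j0) (t + 1 - of_int j0) y"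
      using y by (intro evolve_one_level) (auto simp: t_def)
    then have "evolve l t (t + 1) y = 0" using flow_eq_zero[OF y] j0 by (simp add: t_def)
    then have "evolve l u (t + 1) x = 0"
      using evolve_evolve[of u t "t + 1" x l] t x by (simp add: y_def)
    then have "evolve l u T x = 0"
      using evolve_evolve[of u "t + 1" T x l] t x by simp
    then show ?thesis using T by (intro bexI[OF _ zero_in_ancient]) simp
  next
    case False
    have "real (blk K0) \<le> real (blk K)" using \<open>blk K0 \<le> blk K\<close> by simp
    then have xK0: "real (blk K0) \<le> x" using False by linarith
    have bl: "real (blk (Suc (l i))) \<le> z" if "l i < K0" "real (blk K) \<le> z" for i z
    proof -
      have "real (blk (Suc (l i))) \<le> real (blk K0)" using that blk_mono[of "Suc (l i)" K0] by simp
      then show ?thesis using that \<open>real (blk K0) \<le> real (blk K)\<close> by linarith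
    qed
    have "real (blk K0) * infdist x \<int> \<le> x * infdist x \<int>"
      using xK0 by (intro mult_right_mono infdist_nonneg)
    also have "\<dots> = elevation x" using x by (simp add: elevation_def)
    finally have "real (blk K0) * infdist x \<int> \<le> real (blk K0) * (1/8)" using x by simp
    then have near: "infdist x \<int> \<le> 1/8" using \<open>0 < blk K0\<close> by simp
    \<comment> \<open>Levels \<open>l 0\<close> and \<open>l 1\<close> have their barriers below
      \<open>x\<close>, so \<open>x\<close> is only spread. The first interval is incomplete and may
      do little; the second one expands by \<open>exp 1 \<ge> 2\<close>, enough to reach an
      integer.\<close>
    define x1 where "x1 = evolve l u 1 x"
    have x1: "x1 = spread (exp (1 - u)) x"
      using evolve_one_level[of u 1 0 x l] flow_eq_spread[OF bl[OF K0(2)]] u x False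
      by (simp add: x1_def)
    have x1K: "real (blk K) \<le> x1" unfolding x1 using False by (intro spread_ge) simp
    have near1: "infdist x1 \<int> \<le> 1/8" unfolding x1 using infdist_spread_le near by (rule order_trans)
    define x2 where "x2 = evolve l 1 2 x1"
    have x2: "x2 = spread (exp 1) x1"
      using evolve_one_level[of 1 2 1 x1 l] flow_eq_spread[OF bl[OF K0(3) x1K]] x1K
      by (simp add: x2_def)
    have x2K: "real (blk K) \<le> x2" unfolding x2 using x1K by (rule spread_ge)
    have "2 \<le> exp (1::real)" using exp_ge_add_one_self[of 1] by simp
    then obtain i where i: "x2 = of_int i" using spread_exp_in_Ints[OF near1, of "exp 1"] x2 by auto
    define n where "n = nat i"
    have "0 \<le> i" using x2K i by (metis of_int_0_le_iff of_nat_0_le_iff order_trans)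
    then have x2n: "x2 = real n" using i by (simp add: n_def)
    have nK: "blk K \<le> n" using x2K x2n by simp
    define n' where "n' = jumps l 2 (M - 2) n"
    have "evolve l u 2 x = real n"
      using evolve_evolve[of u 1 2 x l] u x x2n by (simp add: x1_def x2_def)
    moreover have "evolve l 2 (real M) (real n) = real n'"
      using evolve_of_nat[of l 2 "M - 2" n] uT by (simp add: n'_def of_nat_diff)
    ultimately have "evolve l u (real M) x = real n'"
      using evolve_evolve[of u 2 "real M" x l] u x uT by simp
    then have xT: "evolve l u T x = evolve l (real M) T (real n')"
      using evolve_evolve[of u "real M" T x l] u x uT T by simp
    show ?thesis
    proof (cases "n < M * blk K")
      \<comment> \<open>The budget of \<open>ancientI\<close>: \<open>2 ^ (K + 1)\<close> shares of
        \<open>blk K\<close> for the size of \<open>n\<close>, as many for the wait since the last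
        level above \<open>K\<close>.\<close>
      case True
      obtain \<tau> where \<tau>: "2 - 2 ^ (K + 1) \<le> \<tau>" "\<tau> < 2" "K < l \<tau>"
        using l unfolding recurrent_levels_def by blast
      have "nat (2 - \<tau>) \<le> 2 ^ (K + 1)" using \<tau>(1) by (simp add: nat_le_iff)
      then have "nat (2 - \<tau>) * blk K \<le> 2 ^ (K + 1) * blk K" by (rule mult_right_mono) simp
      moreover have "M * blk K \<le> 2 ^ (K + 1) * blk K" using M_le by (rule mult_right_mono) simp
      ultimately have "n + nat (2 - \<tau>) * blk K \<le> 2 ^ (K + 1) * blk K + 2 ^ (K + 1) * blk K"
        using True by linarith
      also have "\<dots> \<le> (2 ^ (K + 2) + 5) * blk K" by (simp add: add_mult_distrib)
      also have "\<dots> \<le> blk (Suc K)" using blk_Suc_ge \<open>K0 < K\<close> by simp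
      finally have "n \<in> ancient l 2" using ancientI[OF l _ nK \<tau>(2,3)] \<open>K0 < K\<close> by simp
      then have "n' \<in> ancient l (int M)"
        using jumps_image_ancient[of l 2 "M - 2"] uT by (auto simp: n'_def of_nat_diff)
      then show ?thesis using xT by (intro bexI[of _ n']) auto
    next
      \<comment> \<open>The \<open>M - 2\<close> steps remove at most
        \<open>(M - 2) * blk K\<close>, so \<open>n'\<close> is still large and hence close to
        \<open>0\<close>, which is always ancient.\<close>
      case False
      have "n \<le> n' + (M - 2) * blk K"
        unfolding n'_def by (rule jumps_ge) (use le_K in auto)
      moreover have "M * blk K = (M - 2) * blk K + 2 * blk K"
        using uT(2) by (metis add_mult_distrib le_add_diff_inverse2)
      ultimately have n'K: "blk K \<le> n'" using False by linarith
      have "evolve l (real M) T (real n') = flow (l (int M)) (real M - real M) (T - real M) (real n')"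
        using evolve_one_level[of "real M" T "int M" "real n'" l] T by simp
      also have "\<dots> = real n'" using bl[OF K0(4), of "real n'"] n'K by (simp add: flow_of_nat_fixed)
      finally have "spike_dist (evolve l u T x) (evolve l (real M) T (real 0)) = nearness (real n')"
        using xT T by (simp add: spike_dist_zero)
      also have "\<dots> \<le> 1 / real n'"
        using n'K \<open>0 < blk K0\<close> \<open>blk K0 \<le> blk K\<close> by (intro nearness_le_inverse) simp
      also have "\<dots> \<le> 1 / real (blk K0)"
        using n'K \<open>0 < blk K0\<close> \<open>blk K0 \<le> blk K\<close> by (intro divide_left_mono) auto
      finally show ?thesis by (intro bexI[OF _ zero_in_ancient])
    qed
  qed
qed

subsection \<open>Independent clocks\<close>

lemma frac_add_frac: "frac (frac x + y) = frac (x + y)" for x y :: real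
proof -
  have "\<lfloor>x - of_int \<lfloor>x\<rfloor> + y\<rfloor> = \<lfloor>x + y - of_int \<lfloor>x\<rfloor>\<rfloor>" by (simp add: algebra_simps)
  also have "\<dots> = \<lfloor>x + y\<rfloor> - \<lfloor>x\<rfloor>" by (rule floor_diff_of_int)
  finally show ?thesis by (simp add: frac_def)
qed

lemma frac_eq_self: "0 \<le> x \<Longrightarrow> x < 1 \<Longrightarrow> frac x = x" for x :: real
  by (simp add: frac_eq)

lemma measurable_frac: "(frac :: real \<Rightarrow> real) \<in> borel_measurable borel"
  unfolding frac_def by measurable

section \<open>Rotation invariance of the uniform distribution\<close>

definition unit_uniform :: "real measure" where
  "unit_uniform = restrict_space lborel {0..<1}"

lemma space_unit_uniform [simp]: "space unit_uniform = {0..<1}"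
  by (simp add: unit_uniform_def space_restrict_space)

lemma sets_unit_uniform: "A \<in> sets unit_uniform \<longleftrightarrow> A \<in> sets borel \<and> A \<subseteq> {0..<1}"
  unfolding unit_uniform_def by (subst sets_restrict_space_iff) auto

lemma emeasure_unit_uniform: "A \<subseteq> {0..<1} \<Longrightarrow> emeasure unit_uniform A = emeasure lborel A"
  unfolding unit_uniform_def by (rule emeasure_restrict_space) auto

lemma prob_space_unit_uniform: "prob_space unit_uniform"
  by (rule prob_spaceI) (simp add: emeasure_unit_uniform)

lemma measurable_to_unit_uniform:
  assumes "f \<in> borel_measurable M" "\<And>x. x \<in> space M \<Longrightarrow> f x \<in> {0..<1}"
  shows "f \<in> M \<rightarrow>\<^sub>M unit_uniform"
  unfolding unit_uniform_def by (rule measurable_restrict_space2) (use assms in auto)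

lemma measurable_from_unit_uniform: "(\<lambda>x. x) \<in> borel_measurable unit_uniform"
  unfolding unit_uniform_def by (rule measurable_restrict_space1) simp

lemma emeasure_lborel_shift:
  fixes c :: real
  assumes "A \<in> sets borel"
  shows "emeasure lborel {x. x + c \<in> A} = emeasure lborel A"
proof -
  have "emeasure lborel A = emeasure (distr lborel borel ((+) c)) A" by (simp add: lborel_distr_plus)
  also have "\<dots> = emeasure lborel ((+) c -` A \<inter> space lborel)"
    by (rule emeasure_distr) (use assms in auto)
  also have "(+) c -` A \<inter> space lborel = {x. x + c \<in> A}" by (auto simp: add.commute)
  finally show ?thesis ..
qed

lemma measurable_rotation: "(\<lambda>x. frac (x + a)) \<in> unit_uniform \<rightarrow>\<^sub>M unit_uniform"
  by (intro measurable_to_unit_uniform measurable_compose[OF _ measurable_frac]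
      borel_measurable_add measurable_from_unit_uniform) (auto simp: frac_lt_1)

text \<open>On the unit interval a rotation is translation by \<open>c\<close> or, after wrapping,
  by \<open>c - 1\<close>. Splitting the target at \<open>c\<close> reduces the claim to translation
  invariance of Lebesgue measure.\<close>

lemma distr_rotation: "distr unit_uniform unit_uniform (\<lambda>x. frac (x + a)) = unit_uniform"
proof (rule measure_eqI)
  fix A assume "A \<in> sets (distr unit_uniform unit_uniform (\<lambda>x. frac (x + a)))"
  then have A: "A \<in> sets borel" "A \<subseteq> {0..<1}" by (auto simp: sets_unit_uniform)
  define c where "c = frac a"
  have c: "0 \<le> c" "c < 1" by (auto simp: c_def frac_lt_1)
  define B1 B2 where "B1 = A \<inter> {c..}" and "B2 = A \<inter> {..<c}"
  define C1 C2 where "C1 = {x. x + c \<in> B1}" and "C2 = {x. x + (c - 1) \<in> B2}"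
  have B: "B1 \<in> sets borel" "B2 \<in> sets borel" using A by (auto simp: B1_def B2_def)
  have rot: "frac (x + a) = (if x + c < 1 then x + c else x + (c - 1))" if "x \<in> {0..<1}" for x
  proof -
    have "frac (x + a) = frac (x + c)" using frac_add_frac[of a x] by (simp add: c_def add.commute)
    also have "\<dots> = (if x + c < 1 then x + c else x + (c - 1))"
    proof (cases "x + c < 1")
      case True
      then show ?thesis using that c by (simp add: frac_eq_self)
    next
      case False
      then have "\<lfloor>x + c\<rfloor> = 1" using that c by (simp add: floor_eq_iff)
      then show ?thesis using False by (simp add: frac_def)
    qed
    finally show ?thesis .
  qed
  have "emeasure (distr unit_uniform unit_uniform (\<lambda>x. frac (x + a))) A =
      emeasure unit_uniform ((\<lambda>x. frac (x + a)) -` A \<inter> space unit_uniform)"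
    by (intro emeasure_distr measurable_rotation) (simp add: sets_unit_uniform A)
  also have "(\<lambda>x. frac (x + a)) -` A \<inter> space unit_uniform = C1 \<union> C2"
  proof -
    have "frac (x + a) \<in> A \<longleftrightarrow> x \<in> C1 \<union> C2" if "x \<in> {0..<1}" for x
      using rot[OF that] that A(2) by (auto simp: C1_def C2_def B1_def B2_def)
    moreover have "x \<in> {0..<1}" if "x \<in> C1 \<union> C2" for x
      using that A(2) c by (auto simp: C1_def C2_def B1_def B2_def subset_iff)
    ultimately show ?thesis unfolding space_unit_uniform vimage_def by blast
  qed
  also have "emeasure unit_uniform (C1 \<union> C2) = emeasure lborel (C1 \<union> C2)"
  proof (rule emeasure_unit_uniform)
    show "C1 \<union> C2 \<subseteq> {0..<1}"
      using A(2) c by (auto simp: C1_def C2_def B1_def B2_def subset_iff)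
  qed
  also have "\<dots> = emeasure lborel C1 + emeasure lborel C2"
  proof (rule plus_emeasure[symmetric])
    show "C1 \<in> sets lborel" "C2 \<in> sets lborel"
      unfolding C1_def C2_def using B by measurable
    have False if "x \<in> C1" "x \<in> C2" for x
    proof -
      have "x + c \<in> {0..<1}" "x + (c - 1) \<in> {0..<1}"
        using A(2) that by (auto simp: C1_def C2_def B1_def B2_def)
      then show False by simp
    qed
    then show "C1 \<inter> C2 = {}" by blast
  qed
  also have "\<dots> = emeasure lborel B1 + emeasure lborel B2"
    unfolding C1_def C2_def using B by (simp only: emeasure_lborel_shift)
  also have "\<dots> = emeasure lborel (B1 \<union> B2)"
    using B by (intro plus_emeasure) (auto simp: B1_def B2_def)
  also have "B1 \<union> B2 = A" by (auto simp: B1_def B2_def)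
  also have "emeasure lborel A = emeasure unit_uniform A"
    using A by (simp add: emeasure_unit_uniform)
  finally show "emeasure (distr unit_uniform unit_uniform (\<lambda>x. frac (x + a))) A = emeasure unit_uniform A" .
qed simp

lemma distr_PiM_pointwise:
  assumes M: "\<And>i. i \<in> I \<Longrightarrow> prob_space (M i)"
    and f: "\<And>i. i \<in> I \<Longrightarrow> f i \<in> M i \<rightarrow>\<^sub>M M i" "\<And>i. i \<in> I \<Longrightarrow> distr (M i) (M i) (f i) = M i"
  shows "distr (PiM I M) (PiM I M) (\<lambda>\<omega>. \<lambda>i\<in>I. f i (\<omega> i)) = PiM I M"
proof (rule measure_eqI_PiM_infinite[symmetric, OF refl])
  interpret prob_space "PiM I M" using M by (rule prob_space_PiM)
  show "finite_measure (PiM I M)" by unfold_locales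
  define g where "g = (\<lambda>\<omega>. \<lambda>i\<in>I. f i (\<omega> i))"
  have g: "g \<in> PiM I M \<rightarrow>\<^sub>M PiM I M"
    unfolding g_def
  proof (rule measurable_restrict)
    fix i assume i: "i \<in> I"
    show "(\<lambda>\<omega>. f i (\<omega> i)) \<in> PiM I M \<rightarrow>\<^sub>M M i"
      using measurable_compose[OF measurable_component_singleton[OF i, of M] f(1)[OF i]] .
  qed
  fix A J assume J: "finite J" "J \<subseteq> I" and A: "\<And>i. i \<in> J \<Longrightarrow> A i \<in> sets (M i)"
  define A' where "A' i = f i -` A i \<inter> space (M i)" for i
  have A': "A' i \<in> sets (M i)" if "i \<in> J" for i
    unfolding A'_def using J A that f(1) by (intro measurable_sets[of _ _ "M i"]) auto
  have "PiM I M (prod_emb I M J (Pi\<^sub>E J A)) = (\<Prod>i\<in>J. emeasure (M i) (A i))"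
    using J A M by (intro emeasure_PiM_emb) auto
  also have "\<dots> = (\<Prod>i\<in>J. emeasure (M i) (A' i))"
  proof (rule prod.cong)
    fix i assume "i \<in> J"
    then have "emeasure (distr (M i) (M i) (f i)) (A i) = emeasure (M i) (A' i)"
      unfolding A'_def using J A f(1) by (intro emeasure_distr) auto
    then show "emeasure (M i) (A i) = emeasure (M i) (A' i)" using f(2) J \<open>i \<in> J\<close> by auto
  qed simp
  also have "\<dots> = PiM I M (prod_emb I M J (Pi\<^sub>E J A'))"
    using J A' M by (intro emeasure_PiM_emb[symmetric]) auto
  also have "prod_emb I M J (Pi\<^sub>E J A') = g -` prod_emb I M J (Pi\<^sub>E J A) \<inter> space (PiM I M)"
  proof -
    have gi: "g \<omega> \<in> space (PiM I M)" if "\<omega> \<in> space (PiM I M)" for \<omega>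
      using measurable_space[OF g that] .
    have "(\<forall>i\<in>J. \<omega> i \<in> A' i) \<longleftrightarrow> (\<forall>i\<in>J. g \<omega> i \<in> A i)" if "\<omega> \<in> space (PiM I M)" for \<omega>
      using that J by (auto simp: A'_def g_def space_PiM PiE_iff)
    then show ?thesis
      using gi J unfolding prod_emb_def by (auto simp: space_PiM PiE_iff)
  qed
  also have "emeasure (PiM I M) \<dots> = emeasure (distr (PiM I M) (PiM I M) g) (prod_emb I M J (Pi\<^sub>E J A))"
    using J A by (intro emeasure_distr[symmetric] g sets_PiM_I) auto
  finally show "PiM I M (prod_emb I M J (Pi\<^sub>E J A)) =
    distr (PiM I M) (PiM I M) (\<lambda>\<omega>. \<lambda>i\<in>I. f i (\<omega> i)) (prod_emb I M J (Pi\<^sub>E J A))"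
    unfolding g_def .
qed simp

section \<open>The clocks and the levels they produce\<close>

text \<open>
  The clocks are indexed by the real numbers \<open>real k\<close>, to fit the type of the sample space;
  clock \<open>k\<close> has period \<open>2 ^ k\<close>.
\<close>

definition clocks :: "(real \<Rightarrow> real) measure" where
  "clocks = PiM (range real) (\<lambda>_. unit_uniform)"

definition turn :: "real \<Rightarrow> (real \<Rightarrow> real) \<Rightarrow> real \<Rightarrow> real" where
  "turn t \<omega> = (\<lambda>i\<in>range real. frac (\<omega> i + t * 2 powr - i))"

lemma space_clocks: "\<omega> \<in> space clocks \<Longrightarrow> 0 \<le> \<omega> (real k) \<and> \<omega> (real k) < 1"
  by (auto simp: clocks_def space_PiM PiE_iff)

lemma measurable_clock: "(\<lambda>\<omega>. \<omega> (real k)) \<in> borel_measurable clocks"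
proof -
  have "(\<lambda>\<omega>. \<omega> (real k)) \<in> clocks \<rightarrow>\<^sub>M unit_uniform"
    unfolding clocks_def by (rule measurable_component_singleton) simp
  from measurable_compose[OF this measurable_from_unit_uniform] show ?thesis .
qed

lemma turn_eq: "turn t \<omega> (real k) = frac (\<omega> (real k) + t / 2 ^ k)"
  by (simp add: turn_def powr_minus powr_realpow divide_inverse)

lemma metric_dynamical_system_clocks: "metric_dynamical_system clocks turn"
proof -
  interpret prob_space clocks
    unfolding clocks_def by (intro prob_space_PiM prob_space_unit_uniform)
  show ?thesis
  proof
    have "(\<lambda>p. frac (snd p i + fst p * 2 powr - i)) \<in> borel \<Otimes>\<^sub>M clocks \<rightarrow>\<^sub>M unit_uniform"
      if "i \<in> range real" for i
    proof (rule measurable_to_unit_uniform)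
      from that obtain k where "i = real k" by auto
      have [measurable]: "(\<lambda>p. snd p i) \<in> borel_measurable (borel \<Otimes>\<^sub>M clocks)"
        unfolding \<open>i = real k\<close> by (rule measurable_compose[OF measurable_snd measurable_clock])
      show "(\<lambda>p. frac (snd p i + fst p * 2 powr - i)) \<in> borel_measurable (borel \<Otimes>\<^sub>M clocks)"
        by (rule measurable_compose[OF _ measurable_frac]) measurable
    qed (simp add: frac_lt_1)
    then have "(\<lambda>p. \<lambda>i\<in>range real. frac (snd p i + fst p * 2 powr - i)) \<in> borel \<Otimes>\<^sub>M clocks \<rightarrow>\<^sub>M clocks"
      unfolding clocks_def by (intro measurable_restrict)
    then show "(\<lambda>(t, \<omega>). turn t \<omega>) \<in> borel \<Otimes>\<^sub>M clocks \<rightarrow>\<^sub>M clocks"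
      by (simp add: turn_def case_prod_unfold)
    show "turn 0 \<omega> = \<omega>" if "\<omega> \<in> space clocks" for \<omega>
      using that by (auto simp: fun_eq_iff turn_def clocks_def space_PiM PiE_iff frac_eq_self extensional_def)
    show "turn (s + t) \<omega> = turn s (turn t \<omega>)" if "\<omega> \<in> space clocks" for s t \<omega>
    proof
      fix i show "turn (s + t) \<omega> i = turn s (turn t \<omega>) i"
        by (auto simp: turn_def frac_add_frac algebra_simps)
    qed
    show "distr clocks clocks (turn t) = clocks" for t
      unfolding clocks_def turn_def
      by (intro distr_PiM_pointwise prob_space_unit_uniform measurable_rotation distr_rotation)
  qed
qed

interpretation clocks: metric_dynamical_system clocks turn
  by (rule metric_dynamical_system_clocks)

lemma measurable_turn: "turn t \<in> clocks \<rightarrow>\<^sub>M clocks"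
  using measurable_compose[OF measurable_Pair1' clocks.measurable_shift, of t] by simp

text \<open>Clock \<open>0\<close> has period \<open>1\<close>, and its phase is the time elapsed in
  the current unit interval; so interval \<open>j\<close> lasts from real time
  \<open>j - \<omega> 0\<close> to \<open>j + 1 - \<omega> 0\<close>. Clock \<open>k\<close> rings
  in it if its unwrapped phase passes an integer.\<close>

definition rings :: "(real \<Rightarrow> real) \<Rightarrow> int \<Rightarrow> nat \<Rightarrow> bool" where
  "rings \<omega> j k \<longleftrightarrow> \<lfloor>\<omega> (real k) + (of_int j + 1 - \<omega> 0) / 2 ^ k\<rfloor> \<noteq> \<lfloor>\<omega> (real k) + (of_int j - \<omega> 0) / 2 ^ k\<rfloor>"

text \<open>If infinitely many clocks ring, this is some unspecified number; the cocycle laws hold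
  for any sequence of levels, so no sample point has to be removed.\<close>

definition level :: "(real \<Rightarrow> real) \<Rightarrow> int \<Rightarrow> nat" where
  "level \<omega> j = (LEAST N. \<forall>k>N. \<not> rings \<omega> j k)"

definition tame :: "(real \<Rightarrow> real) \<Rightarrow> bool" where
  "tame \<omega> \<longleftrightarrow> (\<forall>j. \<exists>N. \<forall>k>N. \<not> rings \<omega> j k)"

text \<open>Turning changes unwrapped phases by integers, which cancel in the comparison of floors,
  and moves the origin by the completed revolutions of clock \<open>0\<close>.\<close>

lemma rings_turn: "rings (turn t \<omega>) j k \<longleftrightarrow> rings \<omega> (j + \<lfloor>\<omega> 0 + t\<rfloor>) k"
proof -
  define n where "n = \<lfloor>\<omega> 0 + t\<rfloor>"
  define m where "m = \<lfloor>\<omega> (real k) + t / 2 ^ k\<rfloor>"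
  have 0: "turn t \<omega> 0 = \<omega> 0 + t - of_int n"
    using turn_eq[of t \<omega> 0] by (simp add: n_def frac_def)
  have *: "turn t \<omega> (real k) + (r - turn t \<omega> 0) / 2 ^ k =
      \<omega> (real k) + (r + of_int n - \<omega> 0) / 2 ^ k - of_int m" for r
    unfolding 0 turn_eq by (simp add: frac_def m_def field_simps)
  have fl: "\<lfloor>turn t \<omega> (real k) + (r - turn t \<omega> 0) / 2 ^ k\<rfloor> =
      \<lfloor>\<omega> (real k) + (r + of_int n - \<omega> 0) / 2 ^ k\<rfloor> - m" for r
    unfolding * by (rule floor_diff_of_int)
  then show ?thesis
    unfolding rings_def n_def[symmetric] fl by (simp add: algebra_simps)
qed

lemma level_turn: "level (turn t \<omega>) = (\<lambda>j. level \<omega> (j + \<lfloor>\<omega> 0 + t\<rfloor>))"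
  by (simp add: level_def rings_turn fun_eq_iff)

lemma le_level:
  assumes "tame \<omega>" "rings \<omega> j k"
  shows "k \<le> level \<omega> j"
proof -
  have "\<exists>N. \<forall>k>N. \<not> rings \<omega> j k" using assms(1) by (simp add: tame_def)
  then have "\<forall>k>level \<omega> j. \<not> rings \<omega> j k" unfolding level_def by (rule LeastI_ex)
  then show ?thesis using assms(2) not_less by blast
qed

text \<open>The unwrapped phase of clock \<open>k + 1\<close> grows by exactly \<open>1\<close> over
  \<open>2 ^ (k + 1)\<close> intervals, so its floor changes in one of them.\<close>

lemma recurrent_levels_level:
  assumes "tame \<omega>"
  shows "recurrent_levels (level \<omega>)"
  unfolding recurrent_levels_def
proof (intro allI)
  fix k i
  define q :: nat where "q = 2 ^ (k + 1)"
  define a where "a = i - int q"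
  define f where "f j = \<lfloor>\<omega> (real (k + 1)) + (of_int j - \<omega> 0) / real q\<rfloor>" for j
  have "\<exists>j. a \<le> j \<and> j < i \<and> rings \<omega> j (k + 1)"
  proof (rule ccontr)
    assume no: "\<not> ?thesis"
    have "f (a + int m) = f a" if "m \<le> q" for m
      using that
    proof (induction m)
      case (Suc m)
      then have "\<not> rings \<omega> (a + int m) (k + 1)" using no by (auto simp: a_def)
      then have "f (a + int m + 1) = f (a + int m)" by (simp add: rings_def f_def q_def)
      then show ?case using Suc by (simp add: algebra_simps)
    qed simp
    from this[of q] have "f i = f a" by (simp add: a_def)
    moreover have "\<omega> (real (k + 1)) + (of_int i - \<omega> 0) / real q =
        \<omega> (real (k + 1)) + (of_int a - \<omega> 0) / real q + of_int 1"
      by (simp add: a_def q_def field_simps)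
    then have "f i = f a + 1" unfolding f_def by (simp only: floor_add_int)
    ultimately show False by simp
  qed
  then obtain j where j: "a \<le> j" "j < i" "rings \<omega> j (k + 1)" by blast
  then have "k < level \<omega> j" using le_level[OF assms, of j "k + 1"] by simp
  then show "\<exists>j. i - 2 ^ (k + 1) \<le> j \<and> j < i \<and> k < level \<omega> j"
    using j by (auto simp: a_def q_def)
qed

text \<open>Up to the ends of interval \<open>j\<close>, the phase of clock \<open>k\<close> drifts
  by at most \<open>(\<bar>j\<bar> + 1) / 2 ^ k\<close> from its present value, too little to
  wrap.\<close>

lemma not_rings:
  assumes \<omega>: "0 \<le> \<omega> 0" "\<omega> 0 < 1"
    and k: "(\<bar>of_int j\<bar> + 1) / 2 ^ k \<le> \<omega> (real k)" "\<omega> (real k) < 1 - (\<bar>of_int j\<bar> + 1) / 2 ^ k"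
  shows "\<not> rings \<omega> j k"
proof -
  define \<delta> where "\<delta> = (\<bar>real_of_int j\<bar> + 1) / 2 ^ k"
  have \<delta>: "- \<delta> \<le> r / 2 ^ k \<and> r / 2 ^ k \<le> \<delta>"
    if "- (\<bar>of_int j\<bar> + 1) \<le> r" "r \<le> \<bar>of_int j\<bar> + 1" for r
    using divide_right_mono[OF that(1), of "2 ^ k"] divide_right_mono[OF that(2), of "2 ^ k"]
    by (simp only: \<delta>_def minus_divide_left zero_le_power zero_le_numeral)
  have "\<lfloor>\<omega> (real k) + r / 2 ^ k\<rfloor> = 0"
    if "- (\<bar>of_int j\<bar> + 1) \<le> r" "r \<le> \<bar>of_int j\<bar> + 1" for r
    using \<delta>[OF that] k unfolding \<delta>_def[symmetric] floor_eq_iff by simp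
  from this[of "of_int j - \<omega> 0"] this[of "of_int j + 1 - \<omega> 0"]
  have "\<lfloor>\<omega> (real k) + (of_int j - \<omega> 0) / 2 ^ k\<rfloor> = 0"
    "\<lfloor>\<omega> (real k) + (of_int j + 1 - \<omega> 0) / 2 ^ k\<rfloor> = 0"
    using \<omega> by simp_all
  then show ?thesis by (simp add: rings_def)
qed

lemma prob_clock:
  assumes "A \<in> sets unit_uniform"
  shows "emeasure clocks {\<omega> \<in> space clocks. \<omega> (real k) \<in> A} = emeasure unit_uniform A"
proof -
  interpret U: prob_space unit_uniform by (rule prob_space_unit_uniform)
  interpret product_prob_space "\<lambda>_. unit_uniform" "range real" by unfold_locales
  show ?thesis
    unfolding clocks_def using assms by (intro emeasure_PiM_Collect_single) auto
qed

text \<open>Borel-Cantelli: the phases that let clock \<open>k\<close> ring in interval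
  \<open>j\<close> have total length at most \<open>2 * \<delta> k\<close>, which is geometric in
  \<open>k\<close>.\<close>

lemma AE_tame: "AE \<omega> in clocks. tame \<omega>"
proof -
  have "AE \<omega> in clocks. \<exists>N. \<forall>k>N. \<not> rings \<omega> j k" for j
  proof -
    define \<delta> where "\<delta> k = (\<bar>real_of_int j\<bar> + 1) / 2 ^ k" for k :: nat
    have \<delta>: "0 \<le> \<delta> k" for k by (simp add: \<delta>_def)
    define A where "A k = {x \<in> {0..<1}. x < \<delta> k \<or> 1 - \<delta> k \<le> x}" for k
    define B where "B k = {\<omega> \<in> space clocks. \<omega> (real k) \<in> A k}" for k
    have A: "A k \<in> sets unit_uniform" for k
    proof -
      have "A k = {0..<1} \<inter> ({..<\<delta> k} \<union> {1 - \<delta> k..})" by (auto simp: A_def)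
      then show ?thesis unfolding sets_unit_uniform by simp
    qed
    have "emeasure unit_uniform (A k) \<le> ennreal (2 * \<delta> k)" for k
    proof -
      have "emeasure unit_uniform (A k) = emeasure lborel (A k)"
        by (rule emeasure_unit_uniform) (auto simp: A_def)
      also have "\<dots> \<le> emeasure lborel ({0..\<delta> k} \<union> {1 - \<delta> k..1})"
        by (rule emeasure_mono) (auto simp: A_def)
      also have "\<dots> \<le> emeasure lborel {0..\<delta> k} + emeasure lborel {1 - \<delta> k..1}"
        by (rule emeasure_subadditive) auto
      also have "\<dots> = ennreal (\<delta> k) + ennreal (\<delta> k)" using \<delta>[of k] by simp
      also have "\<dots> = ennreal (2 * \<delta> k)" using \<delta>[of k] by (subst ennreal_plus[symmetric]) simp_all
      finally show ?thesis .
    qed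
    then have le: "emeasure clocks (B k) \<le> ennreal (2 * \<delta> k)" for k
      unfolding B_def prob_clock[OF A] .
    have B: "B k \<in> sets clocks" for k
    proof -
      have [measurable]: "(\<lambda>\<omega>. \<omega> (real k)) \<in> borel_measurable clocks" by (rule measurable_clock)
      have "B k = {\<omega> \<in> space clocks. \<omega> (real k) < \<delta> k \<or> 1 - \<delta> k \<le> \<omega> (real k)}"
        using space_clocks by (auto simp: B_def A_def)
      then show ?thesis by simp
    qed
    have "AE \<omega> in clocks. eventually (\<lambda>k. \<omega> \<in> space clocks - B k) sequentially"
    proof (rule borel_cantelli_AE1[OF B])
      show "emeasure clocks (B k) < \<infinity>" for k
        by (rule le_less_trans[OF le]) simp
      have "summable (\<lambda>k. 2 * (\<bar>real_of_int j\<bar> + 1) * (1/2) ^ k)"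
        by (intro summable_mult summable_geometric) simp
      then have "summable (\<lambda>k. 2 * \<delta> k)" by (simp add: \<delta>_def power_divide)
      then show "summable (\<lambda>k. measure clocks (B k))"
      proof (rule summable_comparison_test')
        fix k assume "k \<ge> (0::nat)"
        have "measure clocks (B k) \<le> 2 * \<delta> k"
          using le[of k] \<delta>[of k] by (simp add: clocks.emeasure_eq_measure)
        then show "norm (measure clocks (B k)) \<le> 2 * \<delta> k" by simp
      qed
    qed
    then show ?thesis
    proof (rule AE_mp, intro AE_I2 impI)
      fix \<omega> assume \<omega>: "\<omega> \<in> space clocks" and "eventually (\<lambda>k. \<omega> \<in> space clocks - B k) sequentially"
      then obtain N where N: "\<And>k. N \<le> k \<Longrightarrow> \<omega> \<notin> B k" by (auto simp: eventually_sequentially)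
      have "\<not> rings \<omega> j k" if "N < k" for k
        using N[of k] that \<omega> space_clocks[OF \<omega>, of k] space_clocks[OF \<omega>, of 0]
        by (intro not_rings) (auto simp: B_def A_def \<delta>_def)
      then show "\<exists>N. \<forall>k>N. \<not> rings \<omega> j k" by blast
    qed
  qed
  then show ?thesis unfolding tame_def by (simp add: AE_all_countable)
qed

lemma measurable_level: "(\<lambda>\<omega>. level \<omega> j) \<in> clocks \<rightarrow>\<^sub>M count_space UNIV"
proof -
  have [measurable]: "(\<lambda>\<omega>. \<omega> (real k)) \<in> borel_measurable clocks" for k by (rule measurable_clock)
  have [measurable]: "(\<lambda>\<omega>. \<omega> 0) \<in> borel_measurable clocks" using measurable_clock[of 0] by simp
  have eq: "rings \<omega> j k \<longleftrightarrow> real_of_int \<lfloor>\<omega> (real k) + (of_int j + 1 - \<omega> 0) / 2 ^ k\<rfloor> \<noteq>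
      real_of_int \<lfloor>\<omega> (real k) + (of_int j - \<omega> 0) / 2 ^ k\<rfloor>" for \<omega> k
    by (simp add: rings_def)
  have [measurable]: "Measurable.pred clocks (\<lambda>\<omega>. rings \<omega> j k)" for k
    unfolding eq by measurable
  show ?thesis unfolding level_def by measurable
qed

subsection \<open>The random dynamical system\<close>

text \<open>Clamping the start time keeps it nonnegative, so the flow becomes continuous on all of
  three-dimensional space, including end times before the start.\<close>

lemma measurable_flow:
  assumes [measurable]: "s \<in> borel_measurable M" "t \<in> borel_measurable M" "x \<in> borel_measurable M"
  shows "(\<lambda>z. flow k (clamp01 (s z)) (t z) (x z)) \<in> borel_measurable M"
proof -
  have "continuous_on UNIV (\<lambda>p :: real \<times> real \<times> real. flow k (clamp01 (fst p)) (fst (snd p)) (snd (snd p)))"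
    unfolding continuous_on_def
    by (intro ballI tendsto_flow tendsto_clamp01 tendsto_fst tendsto_snd tendsto_ident_at) simp
  then have "(\<lambda>p. flow k (clamp01 (fst p)) (fst (snd p)) (snd (snd p))) \<in> borel_measurable borel"
    by (rule borel_measurable_continuous_onI)
  moreover have "(\<lambda>z. (s z, t z, x z)) \<in> borel_measurable M" by measurable
  ultimately have "(\<lambda>z. flow k (clamp01 (fst (s z, t z, x z))) (fst (snd (s z, t z, x z))) (snd (snd (s z, t z, x z))))
      \<in> borel_measurable M"
    by (rule measurable_compose[rotated])
  then show ?thesis by simp
qed

lemma measurable_steps:
  assumes l: "\<And>j. (\<lambda>z. l z j) \<in> M \<rightarrow>\<^sub>M count_space UNIV"
    and s[measurable]: "s \<in> borel_measurable M" and t[measurable]: "t \<in> borel_measurable M"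
    and x: "x \<in> borel_measurable M"
  shows "(\<lambda>z. steps (l z) i m (s z) (t z) (x z)) \<in> borel_measurable M"
proof (induction m)
  case (Suc m)
  have [measurable]: "(\<lambda>z. clamp01 (t z - of_int (i + int m))) \<in> borel_measurable M"
    unfolding clamp01_def by measurable
  define f where "f k z = flow k (clamp01 (s z - of_int (i + int m))) (clamp01 (t z - of_int (i + int m)))
    (steps (l z) i m (s z) (t z) (x z))" for k z
  have "f k \<in> borel_measurable M" for k
    unfolding f_def by (rule measurable_flow[OF _ _ Suc.IH]) measurable
  then have "(\<lambda>z. f (l z (i + int m)) z) \<in> borel_measurable M"
    by (rule measurable_compose_countable[OF _ l])
  then show ?case by (simp add: f_def)
qed (simp add: x)

lemma measurable_evolve:
  assumes l: "\<And>j. (\<lambda>z. l z j) \<in> M \<rightarrow>\<^sub>M count_space UNIV"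
    and s[measurable]: "s \<in> borel_measurable M" and t[measurable]: "t \<in> borel_measurable M"
    and x: "x \<in> borel_measurable M"
  shows "(\<lambda>z. evolve (l z) (s z) (t z) (x z)) \<in> borel_measurable M"
proof -
  have [measurable]: "(\<lambda>z. \<lceil>t z\<rceil>) \<in> M \<rightarrow>\<^sub>M count_space UNIV"
    unfolding ceiling_def by measurable
  have fl: "(\<lambda>z. \<lfloor>s z\<rfloor>) \<in> M \<rightarrow>\<^sub>M count_space UNIV" by measurable
  have len: "(\<lambda>z. nat (\<lceil>t z\<rceil> - \<lfloor>s z\<rfloor>)) \<in> M \<rightarrow>\<^sub>M count_space UNIV" by measurable
  have "(\<lambda>z. steps (l z) i (nat (\<lceil>t z\<rceil> - \<lfloor>s z\<rfloor>)) (s z) (t z) (x z)) \<in> borel_measurable M" for i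
    by (rule measurable_compose_countable[OF measurable_steps[OF assms] len])
  then show ?thesis
    unfolding evolve_def by (rule measurable_compose_countable[OF _ fl])
qed

lemma measurable_spike_dist:
  assumes [measurable]: "f \<in> borel_measurable M" "g \<in> borel_measurable M"
  shows "(\<lambda>z. spike_dist (f z) (g z)) \<in> borel_measurable M"
proof -
  have [measurable]: "nearness \<in> borel_measurable borel" "elevation \<in> borel_measurable borel"
    using continuous_on_nearness continuous_on_elevation by (auto intro: borel_measurable_continuous_onI)
  have eq: "\<lfloor>a\<rfloor> = \<lfloor>b\<rfloor> \<longleftrightarrow> real_of_int \<lfloor>a\<rfloor> = real_of_int \<lfloor>b\<rfloor>" for a b :: real by simp
  show ?thesis unfolding spike_dist_def eq by measurable
qed

text \<open>An arbitrary parameter space \<open>Z\<close> lets this cover continuity of the cocycle,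
  joint continuity and compactness of the attractor.\<close>

lemma continuous_map_evolve:
  assumes s: "continuous_map Z euclideanreal s" and t: "continuous_map Z euclideanreal t"
    and f: "continuous_map Z (mtopology_of spike_space) f"
    and st: "\<And>z. z \<in> topspace Z \<Longrightarrow> s z \<le> t z"
  shows "continuous_map Z (mtopology_of spike_space) (\<lambda>z. point (evolve l (s z) (t z) (f z 0)))"
  unfolding continuous_map_atin limitin_spike_iff
proof (intro ballI conjI)
  fix z0 assume z0: "z0 \<in> topspace Z"
  have nn: "0 \<le> f z 0" if "z \<in> topspace Z" for z
    using continuous_map_image_subset_topspace[OF f] that by auto
  show "point (evolve l (s z0) (t z0) (f z0 0)) \<in> point ` {0..}"
    using nn[OF z0] by (auto intro: evolve_nonneg)
  have top: "\<forall>\<^sub>F z in atin Z z0. z \<in> topspace Z"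
    unfolding eventually_atin by (intro disjI2 exI[of _ "topspace Z"]) (use z0 in auto)
  then show "\<forall>\<^sub>F z in atin Z z0. point (evolve l (s z) (t z) (f z 0)) \<in> point ` {0..}"
    by eventually_elim (auto intro: evolve_nonneg nn)
  have lim: "((\<lambda>z. spike_dist (f z 0) (f z0 0)) \<longlongrightarrow> 0) (atin Z z0)"
    using f z0 unfolding continuous_map_atin limitin_spike_iff by blast
  have "\<forall>\<^sub>F z in atin Z z0. s z \<le> t z \<and> 0 \<le> f z 0"
    using top by eventually_elim (use st nn in auto)
  then show "((\<lambda>z. spike_dist (point (evolve l (s z) (t z) (f z 0)) 0) (point (evolve l (s z0) (t z0) (f z0 0)) 0))
      \<longlongrightarrow> 0) (atin Z z0)"
    unfolding point_zero
    by (intro spike_dist_evolve_tendsto_zero lim st nn z0)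
      (use s t z0 in \<open>auto simp: continuous_map_atin\<close>)
qed

text \<open>Real time \<open>0\<close> is evolution time \<open>\<omega> 0\<close>, so that the unit
  intervals of \<open>evolve\<close> end when clock \<open>0\<close> wraps and the dynamics is
  stationary under all real shifts.\<close>

definition spike_cocycle :: "real \<Rightarrow> (real \<Rightarrow> real) \<Rightarrow> (nat \<Rightarrow> real) \<Rightarrow> nat \<Rightarrow> real" where
  "spike_cocycle t \<omega> f = point (evolve (level \<omega>) (\<omega> 0) (\<omega> 0 + t) (f 0))"

lemma turn_0: "turn t \<omega> 0 = \<omega> 0 + t - of_int \<lfloor>\<omega> 0 + t\<rfloor>"
  using turn_eq[of t \<omega> 0] by (simp add: frac_def)

lemma evolve_turn:
  "evolve (level (turn s \<omega>)) (turn s \<omega> 0) (turn s \<omega> 0 + t) x =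
    evolve (level \<omega>) (\<omega> 0 + s) (\<omega> 0 + s + t) x"
  unfolding level_turn evolve_shift turn_0 by (simp add: add.commute add.left_commute)

lemma random_dynamical_system_spike: "random_dynamical_system clocks turn spike_space spike_cocycle"
proof
  define N where "N = restrict_space borel {0::real..} \<Otimes>\<^sub>M clocks \<Otimes>\<^sub>M borel_of_metric spike_space"
  have t: "(\<lambda>z. fst z) \<in> borel_measurable N"
    unfolding N_def by (intro measurable_compose[OF measurable_fst] measurable_restrict_space1) simp
  have clk: "(\<lambda>z. fst (snd z)) \<in> N \<rightarrow>\<^sub>M clocks" unfolding N_def by measurable
  have pt: "(\<lambda>z. snd (snd z)) \<in> N \<rightarrow>\<^sub>M borel_of_metric spike_space" unfolding N_def by measurable
  have l: "(\<lambda>z. level (fst (snd z)) j) \<in> N \<rightarrow>\<^sub>M count_space UNIV" for j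
    using measurable_compose[OF clk measurable_level] .
  have u: "(\<lambda>z. fst (snd z) 0) \<in> borel_measurable N"
    using measurable_compose[OF clk measurable_clock[of 0]] by simp
  have x: "(\<lambda>z. snd (snd z) 0) \<in> borel_measurable N"
    using measurable_compose[OF pt measurable_coordinate] .
  have "(\<lambda>z. evolve (level (fst (snd z))) (fst (snd z) 0) (fst (snd z) 0 + fst z) (snd (snd z) 0))
      \<in> borel_measurable N"
    by (intro measurable_evolve l u x t borel_measurable_add)
  from measurable_compose[OF this measurable_point]
  have "(\<lambda>z. point (max 0 (evolve (level (fst (snd z))) (fst (snd z) 0) (fst (snd z) 0 + fst z) (snd (snd z) 0))))
      \<in> N \<rightarrow>\<^sub>M borel_of_metric spike_space" .
  moreover have "point (max 0 (evolve (level (fst (snd z))) (fst (snd z) 0) (fst (snd z) 0 + fst z) (snd (snd z) 0))) =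
      (\<lambda>(t, \<omega>, f). spike_cocycle t \<omega> f) z" if "z \<in> space N" for z
  proof -
    have "0 \<le> snd (snd z) 0" using that by (auto simp: N_def space_pair_measure)
    then show ?thesis by (simp add: spike_cocycle_def case_prod_unfold evolve_nonneg)
  qed
  ultimately show "(\<lambda>(t, \<omega>, f). spike_cocycle t \<omega> f) \<in>
      restrict_space borel {0..} \<Otimes>\<^sub>M clocks \<Otimes>\<^sub>M borel_of_metric spike_space \<rightarrow>\<^sub>M borel_of_metric spike_space"
    unfolding N_def[symmetric] by (simp cong: measurable_cong)
next
  fix \<omega> f assume "f \<in> mspace spike_space"
  then show "spike_cocycle 0 \<omega> f = f" by (auto simp: spike_cocycle_def evolve_refl)
next
  fix s t :: real and \<omega> f assume "0 \<le> s" "0 \<le> t" "f \<in> mspace spike_space"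
  then show "spike_cocycle (s + t) \<omega> f = spike_cocycle t (turn s \<omega>) (spike_cocycle s \<omega> f)"
    by (auto simp: spike_cocycle_def evolve_turn evolve_evolve add.assoc)
next
  fix t :: real and \<omega> assume "0 \<le> t"
  then show "continuous_map (mtopology_of spike_space) (mtopology_of spike_space) (spike_cocycle t \<omega>)"
    unfolding spike_cocycle_def by (intro continuous_map_evolve) auto
qed

lemma jointly_continuous_rds_spike: "jointly_continuous_rds clocks turn spike_space spike_cocycle"
  unfolding jointly_continuous_rds_def
proof (intro conjI random_dynamical_system_spike ballI)
  fix \<omega> :: "real \<Rightarrow> real"
  define D where "D = {(s, t). s \<le> (t :: real)}"
  define Z where "Z = prod_topology (top_of_set D) (mtopology_of spike_space)"
  have 1: "continuous_map Z euclidean fst"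
    unfolding Z_def using continuous_map_fst continuous_map_into_fulltopology by blast
  have "continuous_map Z euclideanreal (\<lambda>z. fst (fst z))" "continuous_map Z euclideanreal (\<lambda>z. snd (fst z))"
    by (auto intro!: continuous_map_compose[OF 1, unfolded o_def] continuous_on_fst continuous_on_snd)
  then have st: "continuous_map Z euclideanreal (\<lambda>z. \<omega> 0 + fst (fst z))"
    "continuous_map Z euclideanreal (\<lambda>z. \<omega> 0 + snd (fst z))"
    by (auto intro: continuous_map_add)
  have "continuous_map Z (mtopology_of spike_space)
      (\<lambda>z. point (evolve (level \<omega>) (\<omega> 0 + fst (fst z)) (\<omega> 0 + snd (fst z)) (snd z 0)))"
    by (rule continuous_map_evolve[OF st]) (auto simp: Z_def D_def continuous_map_snd)
  moreover have "spike_cocycle (t - s) (turn s \<omega>) f =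
      point (evolve (level \<omega>) (\<omega> 0 + s) (\<omega> 0 + t) (f 0))" for s t f
    unfolding spike_cocycle_def evolve_turn by simp
  ultimately show "continuous_map (prod_topology (top_of_set {(s, t). s \<le> t}) (mtopology_of spike_space))
      (mtopology_of spike_space) (\<lambda>((s, t), f). spike_cocycle (t - s) (turn s \<omega>) f)"
    by (simp add: case_prod_unfold Z_def D_def)
qed

text \<open>The ancient integers of the start of the current interval, transported through the
  elapsed part of it; between integer times the points need not be integers.\<close>

definition spike_attractor :: "(real \<Rightarrow> real) \<Rightarrow> (nat \<Rightarrow> real) set" where
  "spike_attractor \<omega> = (\<lambda>n. point (evolve (level \<omega>) 0 (\<omega> 0) (real n))) ` ancient (level \<omega>) 0"

lemma spike_attractor_subset: "spike_attractor \<omega> \<subseteq> point ` {0..}"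
  by (auto simp: spike_attractor_def evolve_nonneg)

lemma spike_attractor_nonempty: "spike_attractor \<omega> \<noteq> {}"
  using zero_in_ancient by (auto simp: spike_attractor_def)

lemma compactin_spike_attractor:
  assumes "\<omega> \<in> space clocks"
  shows "compactin (mtopology_of spike_space) (spike_attractor \<omega>)"
proof -
  have "0 \<le> \<omega> 0" using space_clocks[OF assms, of 0] by simp
  then have "continuous_map (mtopology_of spike_space) (mtopology_of spike_space)
      (\<lambda>f. point (evolve (level \<omega>) 0 (\<omega> 0) (f 0)))"
    by (intro continuous_map_evolve) auto
  from image_compactin[OF compactin_point_of_nat[OF zero_in_ancient] this]
  show ?thesis by (simp add: spike_attractor_def image_image)
qed

lemma spike_attractor_turn:
  assumes "\<lfloor>\<omega> 0 + t\<rfloor> = int m"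
  shows "spike_attractor (turn t \<omega>) =
    (\<lambda>n. point (evolve (level \<omega>) (real m) (\<omega> 0 + t) (real n))) ` ancient (level \<omega>) (int m)"
  unfolding spike_attractor_def level_turn turn_0 evolve_shift ancient_shift by (simp add: assms)

lemma spike_cocycle_image_attractor:
  assumes "\<omega> \<in> space clocks" "0 \<le> t"
  shows "spike_cocycle t \<omega> ` spike_attractor \<omega> = spike_attractor (turn t \<omega>)"
proof -
  define l where "l = level \<omega>"
  define u where "u = \<omega> 0"
  define m where "m = nat \<lfloor>u + t\<rfloor>"
  have u: "0 \<le> u" using space_clocks[OF assms(1), of 0] by (simp add: u_def)
  then have "0 \<le> \<lfloor>u + t\<rfloor>" using assms(2) by simp
  then have fl: "\<lfloor>u + t\<rfloor> = int m" by (simp add: m_def)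
  have m: "real m \<le> u + t" using of_int_floor_le[of "u + t"] fl by simp
  have "spike_cocycle t \<omega> ` spike_attractor \<omega> = (\<lambda>n. point (evolve l 0 (u + t) (real n))) ` ancient l 0"
    using assms(2) u unfolding spike_attractor_def spike_cocycle_def
    by (simp add: image_image evolve_evolve l_def u_def)
  also have "\<dots> = (\<lambda>n. point (evolve l (real m) (u + t) (real (jumps l 0 m n)))) ` ancient l 0"
  proof (rule image_cong)
    fix n
    show "point (evolve l 0 (u + t) (real n)) = point (evolve l (real m) (u + t) (real (jumps l 0 m n)))"
      using evolve_of_nat[of l 0 m n] evolve_evolve[of 0 "real m" "u + t" "real n" l] m by simp
  qed simp
  also have "\<dots> = (\<lambda>n. point (evolve l (real m) (u + t) (real n))) ` jumps l 0 m ` ancient l 0"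
    by (simp add: image_image)
  also have "\<dots> = (\<lambda>n. point (evolve l (real m) (u + t) (real n))) ` ancient l (int m)"
    by (simp add: jumps_image_ancient)
  also have "\<dots> = spike_attractor (turn t \<omega>)"
    using fl by (simp add: spike_attractor_turn u_def l_def)
  finally show ?thesis .
qed

section \<open>Measurability of the attractor\<close>

lemma measurable_jumps:
  "(\<lambda>\<omega>. jumps (level \<omega>) i m n) \<in> clocks \<rightarrow>\<^sub>M count_space UNIV"
proof (induction m)
  case (Suc m)
  show ?case
    unfolding jumps.simps
    by (rule measurable_compose_countable[OF measurable_compose_countable[OF _ Suc.IH] measurable_level])
      simp
qed simp

lemma measurable_ancient: "Measurable.pred clocks (\<lambda>\<omega>. n \<in> ancient (level \<omega>) i)"
proof -
  have [measurable]: "(\<lambda>\<omega>. jumps (level \<omega>) j m y) \<in> clocks \<rightarrow>\<^sub>M count_space UNIV" for j m y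
    by (rule measurable_jumps)
  have "Measurable.pred clocks (\<lambda>\<omega>. \<forall>m. \<exists>y. jumps (level \<omega>) (i - int m) m y = n)" by measurable
  then show ?thesis by (simp add: ancient_def)
qed

lemma dist_to_set_spike: "dist_to_set spike_space f A = (INF g\<in>A. spike_dist (f 0) (g 0))"
  by (simp add: dist_to_set_def)

text \<open>An integer that is not ancient is replaced by the point \<open>0\<close>, which lies in
  the attractor anyway; the infimum then runs over a fixed countable index set.\<close>

lemma measurable_dist_to_attractor:
  assumes x: "x \<in> borel_measurable clocks"
  shows "(\<lambda>\<omega>. dist_to_set spike_space (point (x \<omega>)) (spike_attractor \<omega>)) \<in> borel_measurable clocks"
proof -
  define a where "a n \<omega> = (if n \<in> ancient (level \<omega>) 0 then evolve (level \<omega>) 0 (\<omega> 0) (real n) else 0)" for n \<omega>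
  have u: "(\<lambda>\<omega>. \<omega> 0) \<in> borel_measurable clocks" using measurable_clock[of 0] by simp
  have "(\<lambda>\<omega>. a n \<omega>) \<in> borel_measurable clocks" for n
    unfolding a_def using measurable_ancient[of n 0]
    by (intro measurable_If measurable_evolve measurable_level u) (simp_all add: pred_def)
  then have "(\<lambda>\<omega>. INF n. spike_dist (x \<omega>) (a n \<omega>)) \<in> borel_measurable clocks"
    by (intro borel_measurable_cINF_real measurable_spike_dist x) auto
  moreover have "dist_to_set spike_space (point (x \<omega>)) (spike_attractor \<omega>) = (INF n. spike_dist (x \<omega>) (a n \<omega>))"
    if "\<omega> \<in> space clocks" for \<omega>
  proof -
    have "0 \<le> \<omega> 0" using space_clocks[OF that, of 0] by simp
    then have "a 0 \<omega> = 0" by (simp add: a_def)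
    then have "(\<lambda>n. a n \<omega>) ` UNIV = (\<lambda>n. a n \<omega>) ` ancient (level \<omega>) 0"
      using zero_in_ancient[of "level \<omega>" 0] by (auto simp: a_def image_iff split: if_splits)
        (rule bexI[of _ 0], simp_all)
    then have eq: "range (\<lambda>n. spike_dist (x \<omega>) (a n \<omega>)) =
        (\<lambda>n. spike_dist (x \<omega>) (a n \<omega>)) ` ancient (level \<omega>) 0"
      by (metis image_image)
    have "(\<lambda>g. spike_dist (x \<omega>) (g 0)) ` spike_attractor \<omega> =
        (\<lambda>n. spike_dist (x \<omega>) (a n \<omega>)) ` ancient (level \<omega>) 0"
      by (simp add: spike_attractor_def image_image a_def)
    then show ?thesis by (simp add: dist_to_set_spike eq)
  qed
  ultimately show ?thesis by (simp cong: measurable_cong)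
qed

lemma random_compact_set_spike_attractor: "random_compact_set clocks spike_space spike_attractor"
  unfolding random_compact_set_def
proof (intro conjI ballI AE_I2)
  fix f assume "f \<in> mspace spike_space"
  then obtain x where "f = point x" by auto
  then show "(\<lambda>\<omega>. dist_to_set spike_space f (spike_attractor \<omega>)) \<in> borel_measurable clocks"
    using measurable_dist_to_attractor[of "\<lambda>_. x"] by simp
qed (use spike_attractor_subset spike_attractor_nonempty compactin_spike_attractor in simp_all)

lemma dist_to_set_spike_le:
  assumes "g \<in> A"
  shows "dist_to_set spike_space f A \<le> spike_dist (f 0) (g 0)"
  unfolding dist_to_set_spike by (rule cINF_lower) (use assms in \<open>auto intro: bdd_belowI[of _ 0]\<close>)

lemma dist_to_set_spike_triangle:
  assumes "A \<noteq> {}"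
  shows "dist_to_set spike_space f A \<le> spike_dist (f 0) (g 0) + dist_to_set spike_space g A"
proof -
  have "dist_to_set spike_space f A - spike_dist (f 0) (g 0) \<le> spike_dist (g 0) (a 0)" if "a \<in> A" for a
    using dist_to_set_spike_le[OF that, of f] spike_dist_triangle[of "f 0" "a 0" "g 0"] by linarith
  then have "dist_to_set spike_space f A - spike_dist (f 0) (g 0) \<le> dist_to_set spike_space g A"
    using assms by (subst (2) dist_to_set_spike) (intro cINF_greatest)
  then show ?thesis by simp
qed

lemma spike_cocycle_near_attractor:
  assumes \<omega>: "\<omega> \<in> space clocks" "tame \<omega>"
    and K0: "1 \<le> K0" "level \<omega> 0 < K0" "level \<omega> 1 < K0" "level (turn t \<omega>) 0 < K0" "real (2 ^ (K0 + 1) + 2) \<le> t"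
    and x: "0 \<le> x" "8 * elevation x \<le> real (blk K0)"
  shows "dist_to_set spike_space (spike_cocycle t \<omega> (point x)) (spike_attractor (turn t \<omega>)) \<le> 1 / real (blk K0)"
proof -
  define u where "u = \<omega> 0"
  have u: "0 \<le> u" "u < 1" using space_clocks[OF \<omega>(1), of 0] by (simp_all add: u_def)
  define M where "M = nat \<lfloor>u + t\<rfloor>"
  have "0 \<le> t" using K0(5) by (rule order_trans[rotated]) simp
  then have "0 \<le> \<lfloor>u + t\<rfloor>" using u by simp
  then have fl: "\<lfloor>u + t\<rfloor> = int M" by (simp add: M_def)
  have M: "real M \<le> u + t" "u + t < real M + 1" using floor_correct[of "u + t"] fl by simp_all
  have KM: "2 ^ (K0 + 1) + 2 \<le> M"
    unfolding M_def by (rule le_nat_floor) (use K0(5) u in linarith)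
  have "level \<omega> (int M) < K0" using K0(4) fl by (simp add: level_turn u_def)
  then obtain n where n: "n \<in> ancient (level \<omega>) (int M)"
    "spike_dist (evolve (level \<omega>) u (u + t) x) (evolve (level \<omega>) (real M) (u + t) (real n)) \<le> 1 / real (blk K0)"
    using evolve_near_ancient[OF recurrent_levels_level[OF \<omega>(2)] u M K0(1-3) _ KM x] by blast
  have "point (evolve (level \<omega>) (real M) (u + t) (real n)) \<in> spike_attractor (turn t \<omega>)"
    using n(1) fl by (simp add: spike_attractor_turn u_def)
  from dist_to_set_spike_le[OF this, of "spike_cocycle t \<omega> (point x)"] show ?thesis
    using n(2) by (simp add: spike_cocycle_def u_def)
qed

section \<open>Measurability of the supremum over a bounded set\<close>

lemma SUP_ennreal_dense:
  fixes h :: "'a::metric_space \<Rightarrow> real"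
  assumes "continuous_on B h" "C \<subseteq> B" "B \<subseteq> closure C"
  shows "(SUP x\<in>B. ennreal (h x)) = (SUP x\<in>C. ennreal (h x))"
proof (rule antisym)
  show "(SUP x\<in>B. ennreal (h x)) \<le> (SUP x\<in>C. ennreal (h x))"
  proof (rule SUP_least)
    fix x assume x: "x \<in> B"
    then obtain c where c: "\<And>n. c n \<in> C" "c \<longlonglongrightarrow> x"
      using assms(3) closure_sequential[of x C] by blast
    have "\<forall>\<^sub>F n in sequentially. c n \<in> B" using c(1) assms(2) by (auto intro: always_eventually)
    then have "(\<lambda>n. h (c n)) \<longlonglongrightarrow> h x" by (rule continuous_on_tendsto_compose[OF assms(1) c(2) x])
    then have "(\<lambda>n. ennreal (h (c n))) \<longlonglongrightarrow> ennreal (h x)" by (rule tendsto_ennrealI)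
    then show "ennreal (h x) \<le> (SUP x\<in>C. ennreal (h x))"
      by (rule LIMSEQ_le_const2) (use c(1) in \<open>auto intro!: exI[of _ 0] SUP_upper\<close>)
  qed
qed (use assms(2) in \<open>rule SUP_subset_mono, auto\<close>)

text \<open>A countable set that is dense in the ordinary topology is enough, because the distance
  to the attractor depends continuously on the ordinary coordinate.\<close>

lemma measurable_SUP_dist_to_attractor:
  assumes B: "B \<subseteq> point ` {0..}" and t: "0 \<le> t"
  shows "(\<lambda>\<omega>. SUP f\<in>B. ennreal (dist_to_set spike_space (spike_cocycle t (turn (- t) \<omega>) f) (spike_attractor \<omega>)))
    \<in> borel_measurable clocks"
proof -
  define b where "b = (\<lambda>f. f 0) ` B"
  have b: "b \<subseteq> {0..}" "B = point ` b" using B by (auto simp: b_def image_image) force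
  define e where "e \<omega> x = evolve (level (turn (- t) \<omega>)) (turn (- t) \<omega> 0) (turn (- t) \<omega> 0 + t) x" for \<omega> x
  define h where "h \<omega> x = dist_to_set spike_space (point (e \<omega> x)) (spike_attractor \<omega>)" for \<omega> x
  obtain C where C: "countable C" "C \<subseteq> b" "b \<subseteq> closure C" by (rule separable)
  have "(\<lambda>\<omega>. h \<omega> x) \<in> borel_measurable clocks" for x
  proof -
    have l: "(\<lambda>\<omega>. level (turn (- t) \<omega>) j) \<in> clocks \<rightarrow>\<^sub>M count_space UNIV" for j
      using measurable_compose[OF measurable_turn measurable_level] .
    have u: "(\<lambda>\<omega>. turn (- t) \<omega> 0) \<in> borel_measurable clocks"
      using measurable_compose[OF measurable_turn measurable_clock[of 0]] by simp
    show ?thesis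
      unfolding h_def e_def
      by (intro measurable_dist_to_attractor measurable_evolve l u borel_measurable_add) simp_all
  qed
  then have "(\<lambda>\<omega>. SUP x\<in>C. ennreal (h \<omega> x)) \<in> borel_measurable clocks"
    using C(1) by (intro borel_measurable_SUP measurable_compose[OF _ measurable_ennreal])
  moreover have "continuous_on b (h \<omega>)" for \<omega>
    unfolding continuous_on_def
  proof
    fix x assume "x \<in> b"
    have x: "0 \<le> x" using b \<open>x \<in> b\<close> by auto
    have ev: "\<forall>\<^sub>F y in at x within b. 0 \<le> y" using b(1) by (auto simp: eventually_at_filter intro!: always_eventually)
    have "((\<lambda>y. spike_dist (e \<omega> y) (e \<omega> x)) \<longlongrightarrow> 0) (at x within b)"
      unfolding e_def
      by (intro spike_dist_evolve_tendsto_zero spike_dist_tendsto_zero tendsto_const tendsto_ident_at x)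
        (use ev t in auto)
    moreover have "norm (h \<omega> y - h \<omega> x) \<le> spike_dist (e \<omega> y) (e \<omega> x)" for y
      using dist_to_set_spike_triangle[OF spike_attractor_nonempty, of "point (e \<omega> y)" \<omega> "point (e \<omega> x)"]
        dist_to_set_spike_triangle[OF spike_attractor_nonempty, of "point (e \<omega> x)" \<omega> "point (e \<omega> y)"]
        spike_dist_commute[of "e \<omega> x" "e \<omega> y"] by (simp add: h_def abs_le_iff)
    then have "\<forall>\<^sub>F y in at x within b. norm (h \<omega> y - h \<omega> x) \<le> spike_dist (e \<omega> y) (e \<omega> x)" by simp
    ultimately have "((\<lambda>y. h \<omega> y - h \<omega> x) \<longlongrightarrow> 0) (at x within b)"
      by (rule Lim_null_comparison[rotated])
    then show "(h \<omega> \<longlongrightarrow> h \<omega> x) (at x within b)" by (simp add: LIM_zero_iff)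
  qed
  then have "(SUP x\<in>b. ennreal (h \<omega> x)) = (SUP x\<in>C. ennreal (h \<omega> x))" for \<omega>
    using C by (intro SUP_ennreal_dense)
  ultimately have "(\<lambda>\<omega>. SUP x\<in>b. ennreal (h \<omega> x)) \<in> borel_measurable clocks" by simp
  then show ?thesis by (simp add: b(2) image_image h_def e_def spike_cocycle_def)
qed

section \<open>Attraction in probability\<close>

lemma prob_level_tendsto_zero: "(\<lambda>K. clocks.prob {\<omega> \<in> space clocks. K \<le> level \<omega> j}) \<longlonglongrightarrow> 0"
proof -
  define A where "A K = {\<omega> \<in> space clocks. K \<le> level \<omega> j}" for K
  have [measurable]: "(\<lambda>\<omega>. level \<omega> j) \<in> clocks \<rightarrow>\<^sub>M count_space UNIV" by (rule measurable_level)
  have "A K \<in> sets clocks" for K unfolding A_def by measurable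
  then have "(\<lambda>K. clocks.prob (A K)) \<longlonglongrightarrow> clocks.prob (\<Inter>K. A K)"
    by (intro clocks.finite_Lim_measure_decseq) (auto simp: A_def decseq_def)
  moreover have "(\<Inter>K. A K) = {}"
  proof -
    have "\<omega> \<notin> A (Suc (level \<omega> j))" for \<omega> by (simp add: A_def)
    then show ?thesis by blast
  qed
  ultimately show ?thesis by (simp add: A_def)
qed

lemma prob_turn_vimage:
  assumes "A \<in> sets clocks"
  shows "clocks.prob (turn t -` A \<inter> space clocks) = clocks.prob A"
  using measure_distr[OF measurable_turn assms, of t] by (simp add: clocks.shift_invariant)

lemma attracts_bounded:
  assumes "bounded_in_metric spike_space B"
  shows "attracts_in_probability clocks turn spike_space spike_cocycle spike_attractor B"
proof -
  obtain R where B: "B \<subseteq> point ` {0..}" and R: "\<And>f. f \<in> B \<Longrightarrow> elevation (f 0) \<le> R"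
    using bounded_spike_space[OF assms] by blast
  define Y where "Y t \<omega> = (SUP f\<in>B. ennreal (dist_to_set spike_space
    (spike_cocycle t (turn (- t) \<omega>) f) (spike_attractor \<omega>)))" for t \<omega>
  have Y: "Y t \<in> borel_measurable clocks" if "0 \<le> t" for t
    using measurable_SUP_dist_to_attractor[OF B that] by (simp add: Y_def[abs_def])
  have "((\<lambda>t. clocks.prob {\<omega> \<in> space clocks. Y t \<omega> > ennreal \<epsilon>}) \<longlongrightarrow> 0) at_top" if \<epsilon>: "0 < \<epsilon>" for \<epsilon>
  proof (rule tendstoI)
    fix \<delta> :: real assume \<delta>: "0 < \<delta>"
    define L where "L j K = {\<omega> \<in> space clocks. K \<le> level \<omega> j}" for j K
    have L[measurable]: "L j K \<in> sets clocks" for j K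
    proof -
      have [measurable]: "(\<lambda>\<omega>. level \<omega> j) \<in> clocks \<rightarrow>\<^sub>M count_space UNIV" by (rule measurable_level)
      show ?thesis unfolding L_def by measurable
    qed
    have small: "\<forall>\<^sub>F K in sequentially. clocks.prob (L j K) < \<delta> / 3" for j
      using order_tendstoD(2)[OF prob_level_tendsto_zero[of j], of "\<delta> / 3"] \<delta> by (simp add: L_def)
    obtain N1 :: nat where N1: "8 * R \<le> real N1" using real_arch_simple by blast
    obtain N2 :: nat where N2: "1 / \<epsilon> \<le> real N2" using real_arch_simple by blast
    have "\<forall>\<^sub>F K in sequentially. clocks.prob (L 0 K) < \<delta> / 3 \<and> clocks.prob (L 1 K) < \<delta> / 3 \<and>
        1 \<le> K \<and> N1 \<le> K \<and> N2 \<le> K"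
      using small[of 0] small[of 1] by (intro eventually_conj eventually_ge_at_top)
    then obtain K where K: "clocks.prob (L 0 K) < \<delta> / 3" "clocks.prob (L 1 K) < \<delta> / 3"
      "1 \<le> K" "N1 \<le> K" "N2 \<le> K" unfolding eventually_sequentially by blast
    have R8: "8 * R \<le> real (blk K)" using N1 K(4) le_blk[of K] by linarith
    have "1 / \<epsilon> \<le> real (blk K)" using N2 K(5) le_blk[of K] by linarith
    then have blk_\<epsilon>: "1 / real (blk K) \<le> \<epsilon>" using \<epsilon> blk_pos[OF K(3)] by (simp add: field_simps)
    obtain N where N: "{\<omega> \<in> space clocks. \<not> tame \<omega>} \<subseteq> N" "emeasure clocks N = 0" "N \<in> sets clocks"
      using AE_tame by (rule AE_E)
    \<comment> \<open>\<open>E\<close> restricts the start of the window and is evaluated at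
      \<open>turn (- t) \<omega>\<close>, which by invariance does not change its probability; the
      end is controlled by \<open>L 0 K\<close> at \<open>\<omega>\<close>. So the bound is uniform
      in \<open>t\<close>.\<close>
    define E where "E = N \<union> (L 0 K \<union> L 1 K)"
    have E: "E \<in> sets clocks" unfolding E_def using N(3) by measurable
    have "clocks.prob E \<le> clocks.prob N + clocks.prob (L 0 K \<union> L 1 K)"
      unfolding E_def using N(3) L by (intro measure_Un_le) auto
    moreover have "clocks.prob (L 0 K \<union> L 1 K) \<le> clocks.prob (L 0 K) + clocks.prob (L 1 K)"
      using L by (intro measure_Un_le) auto
    moreover have "clocks.prob N = 0" using N(2) by (simp add: measure_def)
    ultimately have PE: "clocks.prob E \<le> clocks.prob (L 0 K) + clocks.prob (L 1 K)" by simp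
    have "clocks.prob {\<omega> \<in> space clocks. Y t \<omega> > ennreal \<epsilon>} < \<delta>" if t: "real (2 ^ (K + 1) + 2) \<le> t" for t
    proof -
      have "{\<omega> \<in> space clocks. Y t \<omega> > ennreal \<epsilon>} \<subseteq> (turn (- t) -` E \<inter> space clocks) \<union> L 0 K"
      proof (rule ccontr)
        assume "\<not> ?thesis"
        then obtain \<omega> where \<omega>: "\<omega> \<in> space clocks" "Y t \<omega> > ennreal \<epsilon>" "turn (- t) \<omega> \<notin> E" "\<omega> \<notin> L 0 K"
          by blast
        define \<omega>' where "\<omega>' = turn (- t) \<omega>"
        have \<omega>': "\<omega>' \<in> space clocks" unfolding \<omega>'_def using measurable_space[OF measurable_turn \<omega>(1)] .
        have turn: "turn t \<omega>' = \<omega>"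
          using clocks.shift_add[OF \<omega>(1), of t "- t"] clocks.shift_zero[OF \<omega>(1)] by (simp add: \<omega>'_def)
        have "tame \<omega>'" "level \<omega>' 0 < K" "level \<omega>' 1 < K" "level \<omega> 0 < K"
          using \<omega> \<omega>' N(1) by (auto simp: E_def L_def \<omega>'_def[symmetric])
        then have near: "dist_to_set spike_space (spike_cocycle t \<omega>' (point x)) (spike_attractor \<omega>) \<le> 1 / real (blk K)"
          if "0 \<le> x" "8 * elevation x \<le> real (blk K)" for x
          using spike_cocycle_near_attractor[OF \<omega>', of K t x] K(3) t that turn by simp
        have "Y t \<omega> \<le> ennreal (1 / real (blk K))"
          unfolding Y_def \<omega>'_def[symmetric]
        proof (rule SUP_least, rule ennreal_leI)
          fix f assume f: "f \<in> B"
          then obtain x where "f = point x" "0 \<le> x" using B by auto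
          then show "dist_to_set spike_space (spike_cocycle t \<omega>' f) (spike_attractor \<omega>) \<le> 1 / real (blk K)"
            using near[of x] R[OF f] R8 by simp
        qed
        also have "\<dots> \<le> ennreal \<epsilon>" using blk_\<epsilon> by (rule ennreal_leI)
        finally show False using \<omega>(2) by simp
      qed
      then have "clocks.prob {\<omega> \<in> space clocks. Y t \<omega> > ennreal \<epsilon>} \<le>
          clocks.prob ((turn (- t) -` E \<inter> space clocks) \<union> L 0 K)"
        using measurable_sets[OF measurable_turn E] L by (intro clocks.finite_measure_mono) auto
      also have "\<dots> \<le> clocks.prob (turn (- t) -` E \<inter> space clocks) + clocks.prob (L 0 K)"
        using measurable_sets[OF measurable_turn E] L by (intro measure_Un_le) auto
      also have "\<dots> < \<delta>" using PE K(1,2) prob_turn_vimage[OF E] by simp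
      finally show ?thesis .
    qed
    then show "\<forall>\<^sub>F t in at_top. dist (clocks.prob {\<omega> \<in> space clocks. Y t \<omega> > ennreal \<epsilon>}) 0 < \<delta>"
      unfolding eventually_at_top_linorder by (intro exI[of _ "real (2 ^ (K + 1) + 2)"]) (auto simp: dist_real_def)
  qed
  then show ?thesis
    unfolding attracts_in_probability_def tendsto_zero_in_probability_def
    using Y by (simp add: Y_def[abs_def])
qed

text \<open>The distance to \<open>0\<close> is continuous and takes countably many values on the
  attractor, at least two of them distinct, whereas a connected set of reals with two points is
  uncountable.\<close>

lemma spike_attractor_disconnected:
  assumes \<omega>: "\<omega> \<in> space clocks" "tame \<omega>"
  shows "\<not> connectedin (mtopology_of spike_space) (spike_attractor \<omega>)"
proof
  assume conn: "connectedin (mtopology_of spike_space) (spike_attractor \<omega>)"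
  define g where "g f = spike_dist (f 0) 0" for f :: "nat \<Rightarrow> real"
  have "continuous_map (mtopology_of spike_space) euclideanreal g"
    unfolding continuous_map_atin limitin_canonical_iff
  proof
    fix f assume f: "f \<in> topspace (mtopology_of spike_space)"
    define F where "F = atin (mtopology_of spike_space) f"
    have "continuous_map (mtopology_of spike_space) (mtopology_of spike_space) (\<lambda>f. f)" by simp
    then have "((\<lambda>h. spike_dist (h 0) (f 0)) \<longlongrightarrow> 0) F"
      using f unfolding continuous_map_atin limitin_spike_iff F_def by blast
    moreover have "norm (g h - g f) \<le> spike_dist (h 0) (f 0)" for h
      using spike_dist_triangle[of "h 0" 0 "f 0"] spike_dist_triangle[of "f 0" 0 "h 0"]
        spike_dist_commute[of "h 0" "f 0"] by (simp add: g_def abs_le_iff)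
    then have "\<forall>\<^sub>F h in F. norm (g h - g f) \<le> spike_dist (h 0) (f 0)" by simp
    ultimately have "((\<lambda>h. g h - g f) \<longlongrightarrow> 0) F" by (rule Lim_null_comparison[rotated])
    then show "(g \<longlongrightarrow> g f) (atin (mtopology_of spike_space) f)" by (simp add: LIM_zero_iff F_def)
  qed
  from connectedin_continuous_map_image[OF this conn]
  have "connected (g ` spike_attractor \<omega>)" by simp
  moreover have "countable (g ` spike_attractor \<omega>)"
    by (simp add: spike_attractor_def countable_subset)
  moreover have "0 \<in> g ` spike_attractor \<omega>"
  proof -
    have "0 \<le> \<omega> 0" using space_clocks[OF \<omega>(1), of 0] by simp
    then have "g (point (evolve (level \<omega>) 0 (\<omega> 0) (real 0))) = 0" by (simp add: g_def)
    then show ?thesis unfolding spike_attractor_def image_image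
      using zero_in_ancient[of "level \<omega>" 0] by (metis (no_types, lifting) image_eqI)
  qed
  moreover have "nearness (real (blk (Suc (level \<omega> 0)))) \<in> g ` spike_attractor \<omega>"
  proof -
    \<comment> \<open>This integer is the barrier of the level in force, so it stays fixed during
      the elapsed part of the interval.\<close>
    define n where "n = blk (Suc (level \<omega> 0))"
    have "evolve (level \<omega>) 0 (\<omega> 0) (real n) = real n"
      using evolve_one_level[of 0 "\<omega> 0" 0 "real n" "level \<omega>"] space_clocks[OF \<omega>(1), of 0]
      by (simp add: n_def flow_of_nat_fixed)
    moreover have "n \<in> ancient (level \<omega>) 0"
      unfolding n_def using recurrent_levels_level[OF \<omega>(2)] by (rule blk_in_ancient) simp
    ultimately have "point (real n) \<in> spike_attractor \<omega>"
      unfolding spike_attractor_def by (metis (no_types, lifting) image_eqI)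
    then have "g (point (real n)) \<in> g ` spike_attractor \<omega>" by (rule imageI)
    then show ?thesis by (simp add: g_def n_def spike_dist_zero)
  qed
  moreover have "0 < blk (Suc (level \<omega> 0))" using blk_pos by simp
  then have "0 \<noteq> nearness (real (blk (Suc (level \<omega> 0))))" by (simp add: nearness_def add_nonneg_eq_0_iff)
  ultimately show False using connected_uncountable by blast
qed

theorem mainTheorem3:
  shows "\<exists>(X :: (nat \<Rightarrow> real) metric) (P :: (real \<Rightarrow> real) measure) \<theta> \<phi> A.
           polish_metric X \<and>
           path_connected_space (mtopology_of X) \<and>
           jointly_continuous_rds P \<theta> X \<phi> \<and>
           weak_attractor P \<theta> X \<phi> A \<and>
           (\<forall>B. bounded_in_metric X B \<longrightarrow> attracts_in_probability P \<theta> X \<phi> A B) \<and>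
           (AE \<omega> in P. \<not> connectedin (mtopology_of X) (A \<omega>))"
proof -
  have "bounded_in_metric spike_space B" if "compactin (mtopology_of spike_space) B" for B
    using spike.compactin_imp_mbounded[of B] that unfolding mtopology_of_spike_space
    by (simp add: spike_space_def)
  then have "weak_attractor clocks turn spike_space spike_cocycle spike_attractor"
    unfolding weak_attractor_def cocycle_invariant_def
    using random_compact_set_spike_attractor attracts_bounded
    by (auto simp: spike_cocycle_image_attractor)
  moreover have "AE \<omega> in clocks. \<not> connectedin (mtopology_of spike_space) (spike_attractor \<omega>)"
    using AE_tame AE_space by eventually_elim (rule spike_attractor_disconnected)
  ultimately show ?thesis
    using polish_spike_space path_connected_spike_space jointly_continuous_rds_spike attracts_bounded
    by blast
qed

end
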